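(* Let $(G,c)$ be a tensor network template such that, for some integer $d>0$, every capacity $c_e$ is a power of $d$. Then $\mathrm{MEE}(G,c)=\log\mathrm{QMC}(G,c)$.
   Context: A tensor network template $(G,c)$ consists of a finite undirected graph $G$ with edge set $E$ whose vertex set is partitioned as $S\sqcup T\sqcup V$. Every element of $S$ (inputs) and every element of $T$ (outputs) is an open end of degree $1$; the elements of $V$ are called vertices. For $u\in S\sqcup T$, $e(u)$ denotes the edge incident to $u$. A capacity function $c:E\to\mathbb{Z}_{>0}$ is given, and to each edge $e$ one associates $\mathbb{C}^{c_e}$ with a fixed basis. At each vertex $v$ of degree $d_v$ an ordering $e(v,1),\dots,e(v,d_v)$ of the incident edge-ends is fixed. A tensor assignment $\mathcal T=(\mathcal T_v)_{v\in V}$ chooses $\mathcal T_v\in\bigotimes_{i=1}^{d_v}\mathbb{C}^{c_{e(v,i)}}$ for each $v$. Let $V_S=\bigotimes_{u\in S}\mathbb{C}^{c_{e(u)}}$ and $V_T=\bigotimes_{u\in T}\mathbb{C}^{c_{e(u)}}$. Contracting the network along all edges gives $\beta(G,c;\mathcal T)\in\mathrm{Hom}(V_S,V_T)$, whose matrix entries are $\langle I_T|\beta|I_S\rangle=\sum_W\prod_{v\in V}(\mathcal T_v)_{W|_v}$. Here $W$ ranges over all assignments of basis indices to all edges that agree with $I_S$ on the input edges and with $I_T$ on the output edges, and $W|_v$ is the tuple of indices on $e(v,1),\dots,e(v,d_v)$. An edge cut set is a set $C\subseteq E$ for which there is a partition $S\sqcup T\sqcup V=\bar S\sqcup\bar T$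 with $S\subseteq\bar S$, $T\subseteq\bar T$, and $C$ equal to the set of edges having one endpoint in $\bar S$ and the other in $\bar T$. The quantum min-cut is $\mathrm{QMC}(G,c)=\min_C\prod_{e\in C}c_e$, the minimum taken over all edge cut sets $C$. Entanglement entropy: let $C_{\mathcal T}$ be the matrix of $\beta(G,c;\mathcal T)$ in the fixed bases, and assume $\beta\neq0$. Then $\mathrm{EE}(G,c;\mathcal T)$ is the von Neumann entropy $-\mathrm{Tr}(\rho\log\rho)$ of $\rho=C_{\mathcal T}C_{\mathcal T}^\dagger/\mathrm{Tr}(C_{\mathcal T}C_{\mathcal T}^\dagger)$, with the convention $0\log0=0$. $\mathrm{MEE}(G,c)$ is the maximum of $\mathrm{EE}(G,c;\mathcal T)$ over all $\mathcal T$ with $\beta(G,c;\mathcal T)\ne0$. *)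

theory Defs
  imports "HOL-Analysis.Analysis" "Jordan_Normal_Form.Schur_Decomposition"
    "HOL-Computational_Algebra.Polynomial"
begin

text \<open>A tensor network template.  Nodes have type 'v, edges type 'e.
  S = inputs, T = outputs, V = vertices; E = edge set; ends e = set of endpoints
  of edge e (one endpoint = self-loop, two endpoints = ordinary edge; parallel
  edges are allowed); c = capacity function.\<close>

definition nodes :: "'v set \<Rightarrow> 'v set \<Rightarrow> 'v set \<Rightarrow> 'v set" where
  "nodes S T V = S \<union> T \<union> V"

definition tn_template ::
  "'v set \<Rightarrow> 'v set \<Rightarrow> 'v set \<Rightarrow> 'e set \<Rightarrow> ('e \<Rightarrow> 'v set) \<Rightarrow> ('e \<Rightarrow> nat) \<Rightarrow> bool" where
  "tn_template S T V E ends c \<longleftrightarrow>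
     finite S \<and> finite T \<and> finite V \<and> finite E \<and>
     S \<inter> T = {} \<and> S \<inter> V = {} \<and> T \<inter> V = {} \<and>
     (\<forall>e\<in>E. ends e \<subseteq> nodes S T V \<and> ends e \<noteq> {} \<and> card (ends e) \<le> 2) \<and>
     (\<forall>u\<in>S \<union> T. \<exists>!e. e \<in> E \<and> u \<in> ends e) \<and>
     (\<forall>u\<in>S \<union> T. \<forall>e\<in>E. u \<in> ends e \<longrightarrow> card (ends e) = 2) \<and>
     (\<forall>e\<in>E. c e > 0)"

definition open_edge :: "'e set \<Rightarrow> ('e \<Rightarrow> 'v set) \<Rightarrow> 'v \<Rightarrow> 'e" where
  "open_edge E ends u = (THE e. e \<in> E \<and> u \<in> ends e)"

definition incident :: "'e set \<Rightarrow> ('e \<Rightarrow> 'v set) \<Rightarrow> 'v \<Rightarrow> 'e set" where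
  "incident E ends v = {e \<in> E. v \<in> ends e}"

definition edge_assignments :: "'e set \<Rightarrow> ('e \<Rightarrow> nat) \<Rightarrow> ('e \<Rightarrow> nat) set" where
  "edge_assignments E c = {W. (\<forall>e\<in>E. W e < c e) \<and> (\<forall>e. e \<notin> E \<longrightarrow> W e = 0)}"

text \<open>Basis index tuples of V_S (resp. V_T): one index per open end u \<in> X,
  ranging below c (e(u)); extensional (0 off X).\<close>
definition boundary_indices ::
  "'v set \<Rightarrow> 'e set \<Rightarrow> ('e \<Rightarrow> 'v set) \<Rightarrow> ('e \<Rightarrow> nat) \<Rightarrow> ('v \<Rightarrow> nat) set" where
  "boundary_indices X E ends c =
     {I. (\<forall>u\<in>X. I u < c (open_edge E ends u)) \<and> (\<forall>u. u \<notin> X \<longrightarrow> I u = 0)}"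

text \<open>Restriction of an edge assignment to the edges incident to v: this is the
  tuple W|_v (the ordering of the edge-ends at v is immaterial, so a tensor at v
  is represented as a function of the indices on its incident edges).\<close>
definition restr :: "'e set \<Rightarrow> ('e \<Rightarrow> nat) \<Rightarrow> 'e \<Rightarrow> nat" where
  "restr A W = (\<lambda>e. if e \<in> A then W e else 0)"

text \<open>Matrix entry <I_T| beta(G,c;Tn) |I_S> of the contracted network.
  A tensor assignment Tn gives for each vertex v the tensor Tn v, whose entry
  at index tuple W|_v is Tn v (restr (incident E ends v) W).\<close>
definition beta_entry ::
  "'v set \<Rightarrow> 'v set \<Rightarrow> 'v set \<Rightarrow> 'e set \<Rightarrow> ('e \<Rightarrow> 'v set) \<Rightarrow> ('e \<Rightarrow> nat)
   \<Rightarrow> ('v \<Rightarrow> ('e \<Rightarrow> nat) \<Rightarrow> complex) \<Rightarrow> ('v \<Rightarrow> nat) \<Rightarrow> ('v \<Rightarrow> nat) \<Rightarrow> complex" where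
  "beta_entry S T V E ends c Tn IT IS =
     (\<Sum>W\<in>{W \<in> edge_assignments E c.
              (\<forall>u\<in>S. W (open_edge E ends u) = IS u) \<and>
              (\<forall>u\<in>T. W (open_edge E ends u) = IT u)}.
        \<Prod>v\<in>V. Tn v (restr (incident E ends v) W))"

definition beta_nonzero ::
  "'v set \<Rightarrow> 'v set \<Rightarrow> 'v set \<Rightarrow> 'e set \<Rightarrow> ('e \<Rightarrow> 'v set) \<Rightarrow> ('e \<Rightarrow> nat)
   \<Rightarrow> ('v \<Rightarrow> ('e \<Rightarrow> nat) \<Rightarrow> complex) \<Rightarrow> bool" where
  "beta_nonzero S T V E ends c Tn \<longleftrightarrow>
     (\<exists>IT\<in>boundary_indices T E ends c. \<exists>IS\<in>boundary_indices S E ends c.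
        beta_entry S T V E ends c Tn IT IS \<noteq> 0)"

definition enum_set :: "'a set \<Rightarrow> nat \<Rightarrow> 'a" where
  "enum_set A = (SOME f. bij_betw f {..<card A} A)"

definition beta_matrix ::
  "'v set \<Rightarrow> 'v set \<Rightarrow> 'v set \<Rightarrow> 'e set \<Rightarrow> ('e \<Rightarrow> 'v set) \<Rightarrow> ('e \<Rightarrow> nat)
   \<Rightarrow> ('v \<Rightarrow> ('e \<Rightarrow> nat) \<Rightarrow> complex) \<Rightarrow> complex mat" where
  "beta_matrix S T V E ends c Tn =
     (let RT = boundary_indices T E ends c; RS = boundary_indices S E ends c in
      mat (card RT) (card RS)
        (\<lambda>(i, j). beta_entry S T V E ends c Tn (enum_set RT i) (enum_set RS j)))"

definition mat_trace :: "complex mat \<Rightarrow> complex" where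
  "mat_trace A = (\<Sum>i<dim_row A. A $$ (i, i))"

text \<open>Von Neumann entropy -Tr(rho log rho) of a density matrix rho, computed from
  its eigenvalues (roots of the characteristic polynomial, with multiplicity),
  with the convention 0 log 0 = 0.\<close>
definition von_neumann_entropy :: "complex mat \<Rightarrow> real" where
  "von_neumann_entropy \<rho> =
     - (\<Sum>x\<in>#proots (char_poly \<rho>).
          (if Re x = 0 then 0 else Re x * ln (Re x)))"

definition EE ::
  "'v set \<Rightarrow> 'v set \<Rightarrow> 'v set \<Rightarrow> 'e set \<Rightarrow> ('e \<Rightarrow> 'v set) \<Rightarrow> ('e \<Rightarrow> nat)
   \<Rightarrow> ('v \<Rightarrow> ('e \<Rightarrow> nat) \<Rightarrow> complex) \<Rightarrow> real" where
  "EE S T V E ends c Tn =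
     (let C = beta_matrix S T V E ends c Tn; P = C * mat_adjoint C in
      von_neumann_entropy ((1 / mat_trace P) \<cdot>\<^sub>m P))"

definition is_edge_cut ::
  "'v set \<Rightarrow> 'v set \<Rightarrow> 'v set \<Rightarrow> 'e set \<Rightarrow> ('e \<Rightarrow> 'v set) \<Rightarrow> 'e set \<Rightarrow> bool" where
  "is_edge_cut S T V E ends C \<longleftrightarrow>
     (\<exists>Sb Tb. Sb \<union> Tb = nodes S T V \<and> Sb \<inter> Tb = {} \<and> S \<subseteq> Sb \<and> T \<subseteq> Tb \<and>
        C = {e \<in> E. \<exists>x\<in>ends e. \<exists>y\<in>ends e. x \<in> Sb \<and> y \<in> Tb})"

definition QMC ::
  "'v set \<Rightarrow> 'v set \<Rightarrow> 'v set \<Rightarrow> 'e set \<Rightarrow> ('e \<Rightarrow> 'v set) \<Rightarrow> ('e \<Rightarrow> nat) \<Rightarrow> nat" where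
  "QMC S T V E ends c = Min {\<Prod>e\<in>C. c e | C. is_edge_cut S T V E ends C}"

end

theory Submission
  imports Defs
begin

text \<open>
  Upper bound: along a cut \<open>C\<close> the contraction factors through a space of dimension
  \<open>r = (\<Prod>e\<in>C. c e)\<close>. As \<open>A * B\<close> and \<open>B * A\<close> have the same nonzero eigenvalues,
  the entropy is that of an \<open>r \<times> r\<close> matrix of trace 1 with nonnegative eigenvalues.

  Attainment: split an edge of capacity \<open>d ^ k\<close> into \<open>k\<close> strands of capacity \<open>d\<close>. By Menger's theorem
  there are \<open>m\<close> strand-disjoint paths from the inputs to the outputs, where \<open>d ^ m\<close> is the quantum
  min-cut. Tensors that copy the basis index along each path, and force the index 0 on unused
  strands, contract to a sum of \<open>d ^ m\<close> mutually orthogonal rank one maps of equal norm, so the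
  spectrum is flat. (Edges joining two inputs or two outputs only contribute a fixed vector.)

  Menger's theorem is obtained without augmenting paths. Orient every strand in both directions
  and take a minimal set \<open>D\<close> of arcs all of whose cuts still have size at least \<open>m\<close>. Each arc of \<open>D\<close>
  crosses a tight set, i.e. one whose cut has size exactly \<open>m\<close>. Submodularity makes the tight sets
  a lattice, from which both conservation at the vertices and acyclicity of \<open>D\<close> follow.
\<close>

unbundle no vec_syntax

section \<open>Spectra of products and von Neumann entropy\<close>

lemma char_poly_mult_commute:
  fixes A B :: "'a :: idom mat"
  assumes A: "A \<in> carrier_mat n r" and B: "B \<in> carrier_mat r n"
  shows "monom 1 r * char_poly (A * B) = monom 1 n * char_poly (B * A)"
proof -
  define x :: "'a poly" where "x = [:0, 1:]"
  define a where "a = map_mat (\<lambda>y. [:y:]) A"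
  define b where "b = map_mat (\<lambda>y. [:y:]) B"
  have a: "a \<in> carrier_mat n r" and b: "b \<in> carrier_mat r n"
    using A B by (auto simp: a_def b_def)
  have neg: "map_mat (\<lambda>y. [:- y:]) M = - map_mat (\<lambda>y. [:y:]) M" for M :: "'a mat"
    by (rule eq_matI) auto
  have cAB: "char_poly_matrix (A * B) = x \<cdot>\<^sub>m 1\<^sub>m n + - (a * b)"
    using A unfolding char_poly_matrix_def neg map_poly_mult[OF A B] x_def a_def b_def by auto
  have cBA: "char_poly_matrix (B * A) = x \<cdot>\<^sub>m 1\<^sub>m r + - (b * a)"
    using B unfolding char_poly_matrix_def neg map_poly_mult[OF B A] x_def a_def b_def by auto
  text \<open>Clearing either off-diagonal block of \<open>M\<close> yields one of the two characteristic polynomials.\<close>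
  define M where "M = four_block_mat (x \<cdot>\<^sub>m 1\<^sub>m n) a b (1\<^sub>m r)"
  define L where "L = four_block_mat (1\<^sub>m n) (0\<^sub>m n r) (- b) (1\<^sub>m r)"
  define R where "R = four_block_mat (1\<^sub>m n) (- a) (0\<^sub>m r n) (x \<cdot>\<^sub>m 1\<^sub>m r)"
  have M: "M \<in> carrier_mat (n + r) (n + r)" and L: "L \<in> carrier_mat (n + r) (n + r)"
    and R: "R \<in> carrier_mat (n + r) (n + r)"
    unfolding M_def L_def R_def by (auto intro!: four_block_carrier_mat)
  have "M * L = four_block_mat (x \<cdot>\<^sub>m 1\<^sub>m n + - (a * b)) a (0\<^sub>m r n) (1\<^sub>m r)"
    unfolding M_def L_def
    by (subst mult_four_block_mat[where ?nr1.0 = n and ?nr2.0 = r and ?n1.0 = n and ?n2.0 = r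
          and ?nc1.0 = n and ?nc2.0 = r])
       (use a b in \<open>auto simp: uminus_add_minus_mat\<close>)
  then have "det (M * L) = char_poly (A * B)"
    using a b unfolding char_poly_def cAB
    by (simp add: det_four_block_mat_lower_left_zero[where n = n and m = r])
  moreover have "det L = 1"
    unfolding L_def using b by (subst det_four_block_mat_upper_right_zero[where n = n and m = r]) auto
  ultimately have 1: "det M = char_poly (A * B)"
    using det_mult[OF M L] by simp
  have xa: "x \<cdot>\<^sub>m 1\<^sub>m n * a = x \<cdot>\<^sub>m a" "a * (x \<cdot>\<^sub>m 1\<^sub>m r) = x \<cdot>\<^sub>m a"
    using a mult_smult_assoc_mat[of "1\<^sub>m n" n n a r x] mult_smult_distrib[OF a, of "1\<^sub>m r" r x]
    by auto
  have sw: "- (b * a) + x \<cdot>\<^sub>m 1\<^sub>m r = x \<cdot>\<^sub>m 1\<^sub>m r + - (b * a)"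
    using a b by (intro comm_add_mat) auto
  have "M * R = four_block_mat (x \<cdot>\<^sub>m 1\<^sub>m n) (0\<^sub>m n r) b (x \<cdot>\<^sub>m 1\<^sub>m r + - (b * a))"
    unfolding M_def R_def
    by (subst mult_four_block_mat[where ?nr1.0 = n and ?nr2.0 = r and ?n1.0 = n and ?n2.0 = r
          and ?nc1.0 = n and ?nc2.0 = r])
       (use a b in \<open>auto simp: xa sw uminus_l_inv_mat\<close>)
  then have "det (M * R) = x ^ n * char_poly (B * A)"
    using a b unfolding char_poly_def cBA
    by (simp add: det_four_block_mat_upper_right_zero[where n = n and m = r])
  moreover have "det R = x ^ r"
    unfolding R_def using a by (subst det_four_block_mat_lower_left_zero[where n = n and m = r]) auto
  ultimately have "x ^ r * det M = x ^ n * char_poly (B * A)"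
    using det_mult[OF M R] by (simp add: mult.commute)
  moreover have "x ^ k = monom 1 k" for k
    by (simp add: x_def monom_altdef)
  ultimately show ?thesis using 1 by simp
qed

lemma char_poly_nonzero: "A \<in> carrier_mat n n \<Longrightarrow> char_poly (A :: 'a :: idom mat) \<noteq> 0"
  using degree_monic_char_poly[of A n] by auto

text \<open>The two characteristic polynomials differ only by powers of the variable, all of whose
  roots are 0, so discarding zero roots removes the discrepancy between \<open>n\<close> and
  \<open>r\<close>.\<close>

lemma nonzero_proots_mult_commute:
  fixes A B :: "'a :: idom mat"
  assumes A: "A \<in> carrier_mat n r" and B: "B \<in> carrier_mat r n"
  shows "filter_mset (\<lambda>x. x \<noteq> 0) (proots (char_poly (A * B))) =
    filter_mset (\<lambda>x. x \<noteq> 0) (proots (char_poly (B * A)))"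
proof -
  have nz: "char_poly (A * B) \<noteq> 0" "char_poly (B * A) \<noteq> 0"
    using assms by (auto intro!: char_poly_nonzero)
  have z: "filter_mset (\<lambda>x. x \<noteq> 0) (proots (monom (1::'a) k)) = {#}" for k
    by (auto simp: filter_mset_eq_mempty_iff monom_altdef proots_power)
  have "proots (monom 1 r * char_poly (A * B)) = proots (monom 1 n * char_poly (B * A))"
    using char_poly_mult_commute[OF assms] by simp
  then have "proots (monom 1 r) + proots (char_poly (A * B)) =
      proots (monom 1 n) + proots (char_poly (B * A))"
    using nz by (simp add: proots_mult monom_eq_0_iff)
  from arg_cong[OF this, of "filter_mset (\<lambda>x. x \<noteq> 0)"] show ?thesis
    by (simp add: z)
qed

text \<open>By the convention for 0 log 0, zero eigenvalues contribute nothing. Hence swapping the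
  factors of a product, which can change only the multiplicity of 0, preserves the entropy.\<close>

lemma von_neumann_entropy_nonzero_roots:
  "von_neumann_entropy \<rho> = - (\<Sum>x\<in>#filter_mset (\<lambda>x. x \<noteq> 0) (proots (char_poly \<rho>)).
     (if Re x = 0 then 0 else Re x * ln (Re x)))"
proof -
  have "(\<Sum>x\<in>#M. (if Re x = 0 then 0 else Re x * ln (Re x))) =
     (\<Sum>x\<in>#filter_mset (\<lambda>x. x \<noteq> 0) M. (if Re x = 0 then 0 else Re x * ln (Re x)))" for M
    by (induction M) auto
  then show ?thesis by (simp add: von_neumann_entropy_def)
qed

lemma von_neumann_entropy_mult_commute:
  assumes "A \<in> carrier_mat n r" and "B \<in> carrier_mat r n"
  shows "von_neumann_entropy (A * B) = von_neumann_entropy (B * A)"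
  by (simp add: von_neumann_entropy_nonzero_roots nonzero_proots_mult_commute[OF assms])

lemma mat_trace_mult_commute:
  assumes A: "A \<in> carrier_mat n r" and B: "B \<in> carrier_mat r n"
  shows "mat_trace (A * B) = mat_trace (B * A)"
proof -
  have "mat_trace (A * B) = (\<Sum>i<n. \<Sum>k<r. A $$ (i,k) * B $$ (k,i))"
    using assms by (auto simp: mat_trace_def scalar_prod_def atLeast0LessThan intro!: sum.cong)
  also have "\<dots> = (\<Sum>k<r. \<Sum>i<n. B $$ (k,i) * A $$ (i,k))"
    by (subst sum.swap) (simp add: mult.commute)
  also have "\<dots> = mat_trace (B * A)"
    using assms by (auto simp: mat_trace_def scalar_prod_def atLeast0LessThan intro!: sum.cong)
  finally show ?thesis .
qed

lemma mat_trace_smult: "mat_trace (c \<cdot>\<^sub>m A) = c * mat_trace A" if "dim_col A = dim_row A"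
  using that by (simp add: mat_trace_def sum_distrib_left)

lemma proots_prod_linear_factors:
  "proots (\<Prod>e\<leftarrow>es. [:- e, 1:]) = mset (es :: 'a :: idom list)"
proof (induction es)
  case (Cons a es)
  have "(\<Prod>e\<leftarrow>es. [:- e, 1:]) \<noteq> 0" by (auto simp: prod_list_zero_iff)
  then have "proots ([:- a, 1:] * (\<Prod>e\<leftarrow>es. [:- e, 1:])) = {#a#} + mset es"
    by (subst proots_mult) (auto simp: Cons.IH)
  then show ?case by simp
qed simp

text \<open>The trace is cyclic, hence invariant under the similarity of a Schur decomposition, and
  the diagonal of the triangular factor lists the roots of the characteristic polynomial.\<close>

lemma mat_trace_proots:
  assumes A: "A \<in> carrier_mat n n"
  shows "mat_trace A = (\<Sum>x\<in>#proots (char_poly A). x)"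
proof -
  obtain es where es: "char_poly A = (\<Prod>e\<leftarrow>es. [:- e, 1:])"
    using char_poly_factorized[OF A] by blast
  obtain B P Q where "schur_decomposition A es = (B, P, Q)"
    by (cases "schur_decomposition A es")
  from schur_decomposition[OF A es this] have
    w: "similar_mat_wit A B P Q" and d: "diag_mat B = es" by auto
  from similar_mat_witD2[OF A w] have
    c: "B \<in> carrier_mat n n" "P \<in> carrier_mat n n" "Q \<in> carrier_mat n n"
    and eq: "Q * P = 1\<^sub>m n" "A = P * B * Q" by auto
  have "mat_trace A = mat_trace (Q * (P * B))"
    unfolding eq by (rule mat_trace_mult_commute) (use c in auto)
  also have "Q * (P * B) = B"
    using assoc_mult_mat[OF c(3,2,1)] eq c by simp
  also have "mat_trace B = sum_list es"
    unfolding d[symmetric] diag_mat_def mat_trace_def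
    by (simp add: interv_sum_list_conv_sum_set_nat atLeast0LessThan)
  also have "proots (char_poly A) = mset es"
    by (simp add: es proots_prod_linear_factors)
  then have "sum_list es = (\<Sum>x\<in>#proots (char_poly A). x)"
    by (simp add: sum_mset_sum_list)
  finally show ?thesis .
qed

section \<open>Adjoints and positivity\<close>

lemma mat_adjoint_carrier [simp]:
  "A \<in> carrier_mat n m \<Longrightarrow> mat_adjoint A \<in> carrier_mat m n"
  by (auto simp: mat_adjoint_def mat_of_rows_def)

lemma mat_adjoint_index:
  "A \<in> carrier_mat n m \<Longrightarrow> i < m \<Longrightarrow> j < n \<Longrightarrow> mat_adjoint A $$ (i, j) = cnj (A $$ (j, i))"
  by (auto simp: mat_adjoint_def mat_of_rows_def)

lemma mult_mat_adjoint_index: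
  assumes "C \<in> carrier_mat n m" "i < n" "j < n"
  shows "(C * mat_adjoint C) $$ (i, j) = (\<Sum>k<m. C $$ (i, k) * cnj (C $$ (j, k)))"
proof -
  note A = mat_adjoint_carrier[OF assms(1)]
  have "(C * mat_adjoint C) $$ (i, j) = (\<Sum>k<m. C $$ (i, k) * mat_adjoint C $$ (k, j))"
    using carrier_matD[OF A] carrier_matD[OF assms(1)] assms(2,3)
    by (simp add: scalar_prod_def atLeast0LessThan)
  then show ?thesis
    using assms by (simp add: mat_adjoint_index)
qed

lemma mat_trace_mult_mat_adjoint:
  assumes C: "C \<in> carrier_mat n m"
  shows "mat_trace (C * mat_adjoint C) = of_real (\<Sum>i<n. \<Sum>k<m. (cmod (C $$ (i, k)))\<^sup>2)"
proof -
  have "dim_row (C * mat_adjoint C) = n" using C by auto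
  then show ?thesis
    by (simp add: mat_trace_def mult_mat_adjoint_index[OF C] complex_norm_square
        del: index_mult_mat of_real_power)
qed

text \<open>Pairing the eigenvalue equation with \<open>v\<close> gives \<open>k\<close> times the
  squared norm of \<open>v\<close> on one side and the squared norm of \<open>w\<close>, the adjoint
  of \<open>C\<close> applied to \<open>v\<close>, on the other.\<close>

lemma eigenvalue_mult_mat_adjoint_nonneg:
  fixes C :: "complex mat"
  assumes C: "C \<in> carrier_mat n m" and e: "eigenvalue (C * mat_adjoint C) k"
  shows "\<exists>t\<ge>0. k = of_real t"
proof -
  note Ca = mat_adjoint_carrier[OF C]
  obtain v where v: "v \<in> carrier_vec n" "v \<noteq> 0\<^sub>v n" "(C * mat_adjoint C) *\<^sub>v v = k \<cdot>\<^sub>v v"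
    using e C unfolding eigenvalue_def eigenvector_def by auto
  define s where "s = (\<Sum>i<n. (cmod (v $ i))\<^sup>2)"
  define w where "w j = (\<Sum>i<n. cnj (C $$ (i, j)) * v $ i)" for j
  have cnj_w: "cnj (w j) = (\<Sum>i<n. cnj (v $ i) * C $$ (i, j))" for j
    by (simp add: w_def mult.commute)
  have Pv: "(\<Sum>l<n. (\<Sum>j<m. C $$ (i, j) * cnj (C $$ (l, j))) * v $ l) = k * v $ i" if "i < n" for i
  proof -
    have "((C * mat_adjoint C) *\<^sub>v v) $ i = (\<Sum>l<n. (C * mat_adjoint C) $$ (i, l) * v $ l)"
      using v(1) that carrier_matD[OF C] carrier_matD[OF Ca]
      by (auto simp: scalar_prod_def atLeast0LessThan simp del: index_mult_mat(1) intro!: sum.cong)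
    then show ?thesis
      using v that by (simp add: mult_mat_adjoint_index[OF C])
  qed
  have swap: "cnj (v $ i) * (\<Sum>l<n. (\<Sum>j<m. C $$ (i, j) * cnj (C $$ (l, j))) * v $ l) =
      (\<Sum>j<m. \<Sum>l<n. cnj (v $ i) * C $$ (i, j) * (cnj (C $$ (l, j)) * v $ l))" for i
  proof -
    have "cnj (v $ i) * (\<Sum>l<n. (\<Sum>j<m. C $$ (i, j) * cnj (C $$ (l, j))) * v $ l) =
        (\<Sum>l<n. \<Sum>j<m. cnj (v $ i) * C $$ (i, j) * (cnj (C $$ (l, j)) * v $ l))"
      by (simp only: sum_distrib_left sum_distrib_right mult.assoc)
    also have "\<dots> = (\<Sum>j<m. \<Sum>l<n. cnj (v $ i) * C $$ (i, j) * (cnj (C $$ (l, j)) * v $ l))"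
      by (rule sum.swap)
    finally show ?thesis .
  qed
  have "(\<Sum>i<n. cnj (v $ i) * (\<Sum>l<n. (\<Sum>j<m. C $$ (i, j) * cnj (C $$ (l, j))) * v $ l)) =
      (\<Sum>i<n. cnj (v $ i) * (k * v $ i))"
    by (intro sum.cong) (auto simp: Pv)
  also have "\<dots> = k * of_real s"
    by (simp add: s_def sum_distrib_left complex_norm_square mult_ac del: of_real_power)
  also have "(\<Sum>i<n. cnj (v $ i) * (\<Sum>l<n. (\<Sum>j<m. C $$ (i, j) * cnj (C $$ (l, j))) * v $ l)) =
      (\<Sum>i<n. \<Sum>j<m. \<Sum>l<n. cnj (v $ i) * C $$ (i, j) * (cnj (C $$ (l, j)) * v $ l))"
    by (simp add: swap)
  also have "\<dots> = (\<Sum>j<m. \<Sum>i<n. \<Sum>l<n. cnj (v $ i) * C $$ (i, j) * (cnj (C $$ (l, j)) * v $ l))"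
    by (rule sum.swap)
  also have "\<dots> = (\<Sum>j<m. cnj (w j) * w j)"
    unfolding cnj_w unfolding w_def sum_product ..
  also have "\<dots> = of_real (\<Sum>j<m. (cmod (w j))\<^sup>2)"
    by (simp add: complex_norm_square mult_ac del: of_real_power)
  finally have eq: "k * of_real s = of_real (\<Sum>j<m. (cmod (w j))\<^sup>2)" by simp
  obtain i where i: "i < n" "v $ i \<noteq> 0" using v(1,2) by (metis eq_vecI carrier_vecD index_zero_vec)
  have "s > 0"
    unfolding s_def using i by (intro sum_pos2[of _ i]) auto
  then have "k = of_real ((\<Sum>j<m. (cmod (w j))\<^sup>2) / s)"
    using eq by (simp add: field_simps)
  moreover have "(\<Sum>j<m. (cmod (w j))\<^sup>2) / s \<ge> 0"
    using \<open>s > 0\<close> by (intro divide_nonneg_pos sum_nonneg) auto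
  ultimately show ?thesis by blast
qed

section \<open>Entropy and rank\<close>

lemma smult_mat_mat_vec:
  assumes "A \<in> carrier_mat n m" "v \<in> carrier_vec m"
  shows "(c \<cdot>\<^sub>m A) *\<^sub>v v = c \<cdot>\<^sub>v (A *\<^sub>v v)"
  using assms by (intro eq_vecI) (auto simp: smult_scalar_prod_distrib[of _ m])

text \<open>A termwise Gibbs inequality against the uniform distribution:
  \<open>ln y \<le> y - 1\<close> at \<open>y = 1 / (r * p)\<close>, multiplied by \<open>p\<close>.
  The slack \<open>1 / r - p\<close> cancels when summed over \<open>r\<close> numbers of sum
  1.\<close>

lemma minus_xlnx_le:
  fixes p :: real
  assumes "p \<ge> 0" "r > 0"
  shows "- (if p = 0 then 0 else p * ln p) \<le> p * ln r + (1 / r - p)"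
proof (cases "p = 0")
  case False
  with assms have p: "p > 0" by simp
  have "ln (1 / (r * p)) \<le> 1 / (r * p) - 1"
    using p assms by (intro ln_le_minus_one) simp
  then have "p * ln (1 / (r * p)) \<le> p * (1 / (r * p) - 1)"
    using p by (intro mult_left_mono) auto
  also have "p * (1 / (r * p) - 1) = 1 / r - p"
    using p by (simp add: field_simps)
  also have "p * ln (1 / (r * p)) = - (p * ln p) - p * ln r"
    using p assms by (simp add: ln_div ln_mult algebra_simps)
  finally show ?thesis using p by simp
qed (use assms in simp)

text \<open>Swapping factors gives an \<open>r\<close> by \<open>r\<close> matrix \<open>M\<close>
  with the same entropy, whose \<open>r\<close> roots sum to 1; the termwise bound then adds up to
  \<open>ln r\<close>. Nonnegativity of the roots has to be imported from \<open>P\<close>, since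
  \<open>M\<close> need not be Hermitian.\<close>

lemma von_neumann_entropy_le_ln_rank:
  assumes A: "A \<in> carrier_mat n r" and B: "B \<in> carrier_mat r m" and C: "C = A * B"
    and P: "P = C * mat_adjoint C" and tr: "mat_trace P \<noteq> 0" and r: "r > 0"
  shows "von_neumann_entropy ((1 / mat_trace P) \<cdot>\<^sub>m P) \<le> ln (real r)"
proof -
  define c where "c = 1 / mat_trace P"
  define \<rho> where "\<rho> = c \<cdot>\<^sub>m P"
  have Cc: "C \<in> carrier_mat n m" using A B C by auto
  note Ca = mat_adjoint_carrier[OF Cc]
  define X where "X = B * mat_adjoint C"
  have X: "X \<in> carrier_mat r n" and Pc: "P \<in> carrier_mat n n"
    using B Ca Cc by (auto simp: X_def P)
  have A': "c \<cdot>\<^sub>m A \<in> carrier_mat n r" using A by auto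
  have "P = A * X"
    unfolding P X_def by (subst C) (rule assoc_mult_mat[OF A B Ca])
  then have \<rho>: "\<rho> = c \<cdot>\<^sub>m A * X"
    unfolding \<rho>_def using mult_smult_assoc_mat[OF A X] by simp
  define M where "M = X * (c \<cdot>\<^sub>m A)"
  have M: "M \<in> carrier_mat r r" using X A' by (auto simp: M_def)
  define t where "t = (\<Sum>i<n. \<Sum>k<m. (cmod (C $$ (i, k)))\<^sup>2)"
  have t: "mat_trace P = of_real t" "t \<ge> 0"
    unfolding P t_def by (auto simp: mat_trace_mult_mat_adjoint[OF Cc] intro!: sum_nonneg)
  have "mat_trace M = mat_trace \<rho>"
    unfolding \<rho> M_def by (rule mat_trace_mult_commute[OF X A'])
  also have "\<dots> = 1" using tr Pc by (simp add: \<rho>_def c_def mat_trace_smult)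
  finally have "(\<Sum>x\<in>#proots (char_poly M). x) = 1"
    using mat_trace_proots[OF M] by simp
  moreover have "Re (\<Sum>x\<in>#N. x) = (\<Sum>x\<in>#N. Re x)" for N
    by (induction N) auto
  ultimately have sum1: "(\<Sum>x\<in>#proots (char_poly M). Re x) = 1"
    by (metis one_complex.sel(1))
  have size: "size (proots (char_poly M)) = r"
    using degree_monic_char_poly[OF M] by (simp add: size_proots_complex)
  \<comment> \<open>A nonzero root of \<open>M\<close> is an eigenvalue of \<open>\<rho>\<close>;
    rescaling by the trace makes it one of \<open>P\<close>, hence a nonnegative real.\<close>
  have nonneg: "Re x \<ge> 0" if x: "x \<in># proots (char_poly M)" for x
  proof (cases "x = 0")
    case False
    with x have "x \<in># filter_mset (\<lambda>x. x \<noteq> 0) (proots (char_poly M))" by simp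
    also have "filter_mset (\<lambda>x. x \<noteq> 0) (proots (char_poly M)) = filter_mset (\<lambda>x. x \<noteq> 0) (proots (char_poly \<rho>))"
      unfolding M_def \<rho> by (rule nonzero_proots_mult_commute[OF X A'])
    finally have "x \<in># proots (char_poly \<rho>)" by simp
    moreover have \<rho>c: "\<rho> \<in> carrier_mat n n" using Pc by (simp add: \<rho>_def)
    ultimately have "eigenvalue \<rho> x"
      using char_poly_nonzero[OF \<rho>c] eigenvalue_root_char_poly[OF \<rho>c] by simp
    then obtain v where v: "v \<in> carrier_vec n" "v \<noteq> 0\<^sub>v n" "\<rho> *\<^sub>v v = x \<cdot>\<^sub>v v"
      using \<rho>c unfolding eigenvalue_def eigenvector_def by auto
    have "mat_trace P \<cdot>\<^sub>m \<rho> = P"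
      using tr by (intro eq_matI) (auto simp: \<rho>_def c_def)
    then have "P *\<^sub>v v = (mat_trace P * x) \<cdot>\<^sub>v v"
      using v \<rho>c smult_mat_mat_vec[OF \<rho>c v(1), of "mat_trace P"] by (simp add: smult_smult_assoc)
    then have "eigenvalue P (mat_trace P * x)"
      using v Pc unfolding eigenvalue_def eigenvector_def by auto
    then obtain s where "s \<ge> 0" "mat_trace P * x = of_real s"
      using eigenvalue_mult_mat_adjoint_nonneg[OF Cc] unfolding P by blast
    then have "x = of_real (s / t)" "s / t \<ge> 0"
      using t tr by (auto simp: field_simps)
    then show ?thesis by simp
  qed simp
  have neg: "- (\<Sum>x\<in>#N. f x) = (\<Sum>x\<in>#N. - f x)" for N and f :: "complex \<Rightarrow> real"
    by (induction N) auto
  have lin: "(\<Sum>x\<in>#N. Re x * ln r + (1 / r - Re x)) =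
      (\<Sum>x\<in>#N. Re x) * ln r + (size N / r - (\<Sum>x\<in>#N. Re x))" for N
    by (induction N) (auto simp: algebra_simps add_divide_distrib)
  have "von_neumann_entropy \<rho> = von_neumann_entropy M"
    unfolding M_def \<rho> by (rule von_neumann_entropy_mult_commute[OF A' X])
  also have "\<dots> = (\<Sum>x\<in>#proots (char_poly M). - (if Re x = 0 then 0 else Re x * ln (Re x)))"
    by (simp add: von_neumann_entropy_def neg)
  also have "\<dots> \<le> (\<Sum>x\<in>#proots (char_poly M). Re x * ln r + (1 / r - Re x))"
    by (intro sum_mset_mono minus_xlnx_le nonneg) (use r in auto)
  also have "\<dots> = (\<Sum>x\<in>#proots (char_poly M). Re x) * ln r
      + (size (proots (char_poly M)) / r - (\<Sum>x\<in>#proots (char_poly M). Re x))"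
    by (rule lin)
  also have "\<dots> = ln r" using r by (simp add: sum1 size)
  finally show ?thesis by (simp add: \<rho>_def c_def)
qed

lemma von_neumann_entropy_maximally_mixed:
  assumes "r > 0"
  shows "von_neumann_entropy ((1 / of_nat r) \<cdot>\<^sub>m 1\<^sub>m r) = ln (real r)"
proof -
  let ?M = "(1 / of_nat r) \<cdot>\<^sub>m 1\<^sub>m r :: complex mat"
  have "char_poly ?M = (\<Prod>a\<leftarrow>diag_mat ?M. [:- a, 1:])"
    by (rule char_poly_upper_triangular[of _ r]) auto
  moreover have "diag_mat ?M = replicate r (1 / of_nat r)"
    by (auto simp: diag_mat_def list_eq_iff_nth_eq)
  ultimately have "proots (char_poly ?M) = replicate_mset r (1 / of_nat r)"
    by (simp only: proots_prod_linear_factors mset_replicate)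
  moreover have "Re (1 / of_nat r) = 1 / r"
    by (metis of_real_of_nat_eq of_real_1 of_real_divide Re_complex_of_real)
  ultimately show ?thesis
    using assms by (simp add: von_neumann_entropy_def ln_div)
qed

lemma mat_adjoint_mult:
  assumes A: "A \<in> carrier_mat n r" and B: "B \<in> carrier_mat r m"
  shows "mat_adjoint (A * B) = mat_adjoint B * (mat_adjoint A :: complex mat)"
proof (rule eq_matI)
  note c = mat_adjoint_carrier[OF A] mat_adjoint_carrier[OF B]
  have AB: "A * B \<in> carrier_mat n m" using A B by auto
  show d: "dim_row (mat_adjoint (A * B)) = dim_row (mat_adjoint B * mat_adjoint A)"
    "dim_col (mat_adjoint (A * B)) = dim_col (mat_adjoint B * mat_adjoint A)"
    using c mat_adjoint_carrier[OF AB] by auto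
  fix i j assume "i < dim_row (mat_adjoint B * mat_adjoint A)" "j < dim_col (mat_adjoint B * mat_adjoint A)"
  then have ij: "i < m" "j < n" using c by auto
  have "mat_adjoint (A * B) $$ (i, j) = cnj (\<Sum>k<r. A $$ (j, k) * B $$ (k, i))"
    unfolding mat_adjoint_index[OF AB ij]
    using ij carrier_matD[OF A] carrier_matD[OF B] by (simp add: scalar_prod_def atLeast0LessThan)
  also have "\<dots> = (\<Sum>k<r. mat_adjoint B $$ (i, k) * mat_adjoint A $$ (k, j))"
    using ij by (simp add: mat_adjoint_index[OF A] mat_adjoint_index[OF B] mult.commute)
  also have "\<dots> = (mat_adjoint B * mat_adjoint A) $$ (i, j)"
    using ij carrier_matD[OF c(1)] carrier_matD[OF c(2)] by (simp add: scalar_prod_def atLeast0LessThan)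
  finally show "mat_adjoint (A * B) $$ (i, j) = (mat_adjoint B * mat_adjoint A) $$ (i, j)" .
qed

text \<open>\<open>P\<close> equals \<open>b\<close> times \<open>G\<close> times its adjoint, and
  swapping these factors gives a multiple of the identity of size \<open>r\<close>. Normalising by
  the trace cancels \<open>a\<close> and \<open>b\<close>, leaving the eigenvalue
  \<open>1 / r\<close> with multiplicity \<open>r\<close> and otherwise zeros.\<close>

lemma von_neumann_entropy_eq_ln_rank:
  fixes a b :: complex
  assumes G: "G \<in> carrier_mat n r" and K: "K \<in> carrier_mat r m" and C: "C = G * K"
    and GG: "mat_adjoint G * G = a \<cdot>\<^sub>m 1\<^sub>m r" and KK: "K * mat_adjoint K = b \<cdot>\<^sub>m 1\<^sub>m r"
    and nz: "a \<noteq> 0" "b \<noteq> 0" "r > 0"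
    and P: "P = C * mat_adjoint C"
  shows "von_neumann_entropy ((1 / mat_trace P) \<cdot>\<^sub>m P) = ln (real r)"
proof -
  note Ga = mat_adjoint_carrier[OF G] and Ka = mat_adjoint_carrier[OF K]
  have "P = G * (K * (mat_adjoint K * mat_adjoint G))"
    unfolding P C mat_adjoint_mult[OF G K]
    by (rule assoc_mult_mat[OF G K]) (use Ga Ka in auto)
  also have "K * (mat_adjoint K * mat_adjoint G) = b \<cdot>\<^sub>m mat_adjoint G"
    using assoc_mult_mat[OF K Ka Ga] KK Ga mult_smult_assoc_mat[of "1\<^sub>m r" r r "mat_adjoint G" n b] by simp
  also have "G * (b \<cdot>\<^sub>m mat_adjoint G) = b \<cdot>\<^sub>m (G * mat_adjoint G)"
    by (rule mult_smult_distrib[OF G Ga])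
  finally have Peq: "P = b \<cdot>\<^sub>m (G * mat_adjoint G)" .
  have "mat_trace (G * mat_adjoint G) = mat_trace (a \<cdot>\<^sub>m 1\<^sub>m r)"
    using mat_trace_mult_commute[OF G Ga] GG by simp
  also have "\<dots> = a * of_nat r" by (simp add: mat_trace_def)
  finally have tr: "mat_trace P = b * (a * of_nat r)"
    unfolding Peq using carrier_matD[OF G] carrier_matD[OF Ga] by (subst mat_trace_smult) auto
  define c where "c = 1 / (a * of_nat r)"
  have "(1 / mat_trace P) \<cdot>\<^sub>m P = c \<cdot>\<^sub>m (G * mat_adjoint G)"
    unfolding tr c_def using nz by (subst Peq, intro eq_matI) auto
  also have "\<dots> = G * (c \<cdot>\<^sub>m mat_adjoint G)"
    by (rule mult_smult_distrib[OF G Ga, symmetric])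
  also have "von_neumann_entropy \<dots> = von_neumann_entropy (c \<cdot>\<^sub>m mat_adjoint G * G)"
    by (rule von_neumann_entropy_mult_commute[OF G]) (use Ga in auto)
  also have "c \<cdot>\<^sub>m mat_adjoint G * G = (1 / of_nat r) \<cdot>\<^sub>m 1\<^sub>m r"
    unfolding mult_smult_assoc_mat[OF Ga G] GG c_def using nz by (intro eq_matI) auto
  also have "von_neumann_entropy \<dots> = ln (real r)"
    by (rule von_neumann_entropy_maximally_mixed) fact
  finally show ?thesis .
qed

section \<open>Factorisation through a cut\<close>

lemma bij_betw_enum_set: "finite A \<Longrightarrow> bij_betw (enum_set A) {..<card A} A"
  unfolding enum_set_def using someI_ex[OF ex_bij_betw_nat_finite[of A]]
  by (simp add: atLeast0LessThan)

text \<open>Uses the same enumeration as \<open>beta_matrix\<close>, so that the arbitrary choice in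
  \<open>enum_set\<close> can be confined here: products, adjoints and scalar matrices are then
  computed on functions of the original indices.\<close>

definition fun_mat :: "'a set \<Rightarrow> 'b set \<Rightarrow> ('a \<Rightarrow> 'b \<Rightarrow> 'c) \<Rightarrow> 'c mat" where
  "fun_mat A B f = mat (card A) (card B) (\<lambda>(i, j). f (enum_set A i) (enum_set B j))"

lemma fun_mat_carrier [simp]: "fun_mat A B f \<in> carrier_mat (card A) (card B)"
  by (simp add: fun_mat_def)

lemma fun_mat_cong:
  assumes "finite A" "finite B" "\<And>x y. x \<in> A \<Longrightarrow> y \<in> B \<Longrightarrow> f x y = g x y"
  shows "fun_mat A B f = fun_mat A B g"
proof -
  have "enum_set A i \<in> A" if "i < card A" for i
    using bij_betw_enum_set[OF assms(1)] that by (auto simp: bij_betw_def)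
  moreover have "enum_set B i \<in> B" if "i < card B" for i
    using bij_betw_enum_set[OF assms(2)] that by (auto simp: bij_betw_def)
  ultimately show ?thesis using assms(3) by (auto simp: fun_mat_def intro!: eq_matI)
qed

lemma fun_mat_mult:
  fixes f :: "'a \<Rightarrow> 'b \<Rightarrow> 'd :: semiring_0"
  assumes "finite B"
  shows "fun_mat A B f * fun_mat B C g = fun_mat A C (\<lambda>x z. \<Sum>y\<in>B. f x y * g y z)"
proof (rule eq_matI)
  fix i j assume ij: "i < dim_row (fun_mat A C (\<lambda>x z. \<Sum>y\<in>B. f x y * g y z))"
    "j < dim_col (fun_mat A C (\<lambda>x z. \<Sum>y\<in>B. f x y * g y z))"
  then have "(fun_mat A B f * fun_mat B C g) $$ (i, j) =
      (\<Sum>k<card B. f (enum_set A i) (enum_set B k) * g (enum_set B k) (enum_set C j))"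
    by (simp add: fun_mat_def scalar_prod_def atLeast0LessThan)
  also have "\<dots> = (\<Sum>y\<in>B. f (enum_set A i) y * g y (enum_set C j))"
    using bij_betw_enum_set[OF assms] by (rule sum.reindex_bij_betw)
  finally show "(fun_mat A B f * fun_mat B C g) $$ (i, j) =
      fun_mat A C (\<lambda>x z. \<Sum>y\<in>B. f x y * g y z) $$ (i, j)"
    using ij by (simp add: fun_mat_def)
qed (simp_all add: fun_mat_def)

lemma mat_adjoint_fun_mat: "mat_adjoint (fun_mat A B f) = fun_mat B A (\<lambda>y x. cnj (f x y))"
proof (rule eq_matI)
  show "dim_row (mat_adjoint (fun_mat A B f)) = dim_row (fun_mat B A (\<lambda>y x. cnj (f x y)))"
    "dim_col (mat_adjoint (fun_mat A B f)) = dim_col (fun_mat B A (\<lambda>y x. cnj (f x y)))"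
    using carrier_matD[OF mat_adjoint_carrier[OF fun_mat_carrier[of A B f]]]
    by (simp_all add: carrier_matD[OF fun_mat_carrier])
  fix i j assume "i < dim_row (fun_mat B A (\<lambda>y x. cnj (f x y)))"
    "j < dim_col (fun_mat B A (\<lambda>y x. cnj (f x y)))"
  then have ij: "i < card B" "j < card A" by (simp_all add: fun_mat_def)
  show "mat_adjoint (fun_mat A B f) $$ (i, j) = fun_mat B A (\<lambda>y x. cnj (f x y)) $$ (i, j)"
    unfolding mat_adjoint_index[OF fun_mat_carrier ij] using ij by (simp add: fun_mat_def)
qed

lemma fun_mat_diagonal:
  assumes "finite A"
  shows "fun_mat A A (\<lambda>x y. if x = y then a else 0) = (a :: 'a :: semiring_1) \<cdot>\<^sub>m 1\<^sub>m (card A)"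
  using bij_betw_imp_inj_on[OF bij_betw_enum_set[OF assms]]
  by (intro eq_matI) (auto simp: fun_mat_def inj_on_def)

text \<open>The trace is the sum of the squared moduli of all entries, so one nonzero entry
  suffices. This makes the normalisation in \<open>EE\<close> meaningful.\<close>

lemma fun_mat_nonzero_trace:
  assumes "finite A" "finite B" "x \<in> A" "y \<in> B" "f x y \<noteq> 0"
  shows "mat_trace (fun_mat A B f * mat_adjoint (fun_mat A B f)) \<noteq> 0"
proof -
  obtain i j where ij: "i < card A" "j < card B" "x = enum_set A i" "y = enum_set B j"
    using assms bij_betw_enum_set[of A] bij_betw_enum_set[of B] unfolding bij_betw_def by blast
  have "0 < (cmod (fun_mat A B f $$ (i, j)))\<^sup>2"
    using ij assms(5) by (simp add: fun_mat_def)
  also have "\<dots> \<le> (\<Sum>k<card B. (cmod (fun_mat A B f $$ (i, k)))\<^sup>2)"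
    using ij by (intro member_le_sum) auto
  also have "\<dots> \<le> (\<Sum>l<card A. \<Sum>k<card B. (cmod (fun_mat A B f $$ (l, k)))\<^sup>2)"
    using ij by (intro member_le_sum[of i _ "\<lambda>l. \<Sum>k<card B. (cmod (fun_mat A B f $$ (l, k)))\<^sup>2"])
      (auto intro: sum_nonneg)
  finally show ?thesis
    unfolding mat_trace_mult_mat_adjoint[OF fun_mat_carrier] by (simp only: of_real_eq_0_iff)
qed

lemma edge_assignments_bij:
  "bij_betw (\<lambda>W. restrict W F) (edge_assignments F c) (PiE F (\<lambda>e. {..<c e}))"
  by (rule bij_betw_byWitness[where f' = "restr F"])
     (auto simp: edge_assignments_def restr_def restrict_def fun_eq_iff PiE_def extensional_def)

lemma finite_edge_assignments: "finite F \<Longrightarrow> finite (edge_assignments F c)"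
  using bij_betw_finite[OF edge_assignments_bij[of F c]] by (simp add: finite_PiE)

lemma card_edge_assignments: "finite F \<Longrightarrow> card (edge_assignments F c) = (\<Prod>e\<in>F. c e)"
  using bij_betw_same_card[OF edge_assignments_bij[of F c]] by (simp add: card_PiE)

text \<open>As assignments vanish off their domain, gluing two of them on disjoint sets is pointwise
  addition.\<close>

lemma sum_edge_assignments_Un:
  assumes "finite A" "finite B" "A \<inter> B = {}"
  shows "(\<Sum>W\<in>edge_assignments (A \<union> B) c. f W) =
    (\<Sum>w\<in>edge_assignments A c. \<Sum>u\<in>edge_assignments B c. f (\<lambda>e. w e + u e))"
proof -
  have dj: "x \<in> B \<Longrightarrow> x \<notin> A" "x \<in> A \<Longrightarrow> x \<notin> B" for x using assms(3) by auto
  have "(\<Sum>W\<in>edge_assignments (A \<union> B) c. f W) =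
      (\<Sum>(w, u)\<in>edge_assignments A c \<times> edge_assignments B c. f (\<lambda>e. w e + u e))"
    by (rule sum.reindex_bij_witness[of _ "\<lambda>(w, u) e. w e + u e" "\<lambda>W. (restr A W, restr B W)"])
       (auto simp: edge_assignments_def restr_def fun_eq_iff dj intro!: arg_cong[of _ _ f])
  then show ?thesis by (simp add: sum.cartesian_product)
qed

lemma boundary_indices_eq:
  "boundary_indices X E ends c = edge_assignments X (\<lambda>u. c (open_edge E ends u))"
  by (simp add: boundary_indices_def edge_assignments_def)

lemma beta_matrix_eq:
  "beta_matrix S T V E ends c Tn = fun_mat (boundary_indices T E ends c)
     (boundary_indices S E ends c) (beta_entry S T V E ends c Tn)"
  by (simp add: beta_matrix_def fun_mat_def Let_def)

section \<open>Entropy bounded by cuts\<close>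

locale template =
  fixes S T V :: "'v set" and E :: "'e set" and ends :: "'e \<Rightarrow> 'v set" and c :: "'e \<Rightarrow> nat"
  assumes tn: "tn_template S T V E ends c"
begin

abbreviation oe :: "'v \<Rightarrow> 'e" where "oe \<equiv> open_edge E ends"
abbreviation RS where "RS \<equiv> boundary_indices S E ends c"
abbreviation RT where "RT \<equiv> boundary_indices T E ends c"

lemma finite_sets: "finite S" "finite T" "finite V" "finite E"
  and disjoint: "S \<inter> T = {}" "S \<inter> V = {}" "T \<inter> V = {}"
  and ends: "e \<in> E \<Longrightarrow> ends e \<subseteq> S \<union> T \<union> V" "e \<in> E \<Longrightarrow> ends e \<noteq> {}" "e \<in> E \<Longrightarrow> card (ends e) \<le> 2"
  and c_pos: "e \<in> E \<Longrightarrow> c e > 0"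
  using tn by (auto simp: tn_template_def nodes_def)

lemma oe: assumes "u \<in> S \<union> T" shows "oe u \<in> E" "u \<in> ends (oe u)"
proof -
  have "\<exists>!e. e \<in> E \<and> u \<in> ends e" using tn assms by (auto simp: tn_template_def)
  from theI'[OF this] show "oe u \<in> E" "u \<in> ends (oe u)" by (auto simp: open_edge_def)
qed

lemma oe_unique: assumes "u \<in> S \<union> T" "e \<in> E" "u \<in> ends e" shows "oe u = e"
proof -
  have "\<exists>!e. e \<in> E \<and> u \<in> ends e" using tn assms(1) by (auto simp: tn_template_def)
  then show ?thesis using oe[OF assms(1)] assms by blast
qed

lemma finite_RS: "finite RS" and finite_RT: "finite RT"
  using finite_sets by (auto simp: boundary_indices_eq finite_edge_assignments)

text \<open>An edge outside the cut lies entirely on one side. Once the indices on the cut are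
  fixed, the sum over assignments therefore splits into a factor for the output side and one for the
  input side.\<close>

lemma beta_factorises:
  assumes C: "is_edge_cut S T V E ends C"
  obtains f g where "\<And>IT IS. beta_entry S T V E ends c Tn IT IS =
    (\<Sum>w\<in>edge_assignments C c. f IT w * g w IS)"
proof -
  obtain Sb Tb where ST: "Sb \<union> Tb = S \<union> T \<union> V" "Sb \<inter> Tb = {}" "S \<subseteq> Sb" "T \<subseteq> Tb"
    and C_eq: "C = {e \<in> E. \<exists>x\<in>ends e. \<exists>y\<in>ends e. x \<in> Sb \<and> y \<in> Tb}"
    using C by (auto simp: is_edge_cut_def nodes_def)
  define ES where "ES = {e \<in> E. ends e \<subseteq> Sb}"
  define ET where "ET = {e \<in> E. ends e \<subseteq> Tb}"
  have E: "E = C \<union> (ES \<union> ET)"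
    using ST(1) ends(1) unfolding C_eq ES_def ET_def by blast
  have dj: "C \<inter> (ES \<union> ET) = {}" "ES \<inter> ET = {}"
    using ST(2) ends(2) unfolding C_eq ES_def ET_def by blast+
  have fin: "finite C" "finite ES" "finite ET" using finite_sets E by auto
  \<comment> \<open>The contribution of one side: boundary conditions at the open ends in
    \<open>X\<close>, tensors at the vertices in \<open>Vx\<close>. It depends only on edges that
    meet \<open>X\<close> or \<open>Vx\<close>.\<close>
  define p where "p X I Vx W = of_bool (\<forall>u\<in>X. W (oe u) = I u) *
      (\<Prod>v\<in>Vx. Tn v (restr (incident E ends v) W))" for X I Vx W
  have p_cong: "p X I Vx W = p X I Vx W'"
    if XST: "X \<subseteq> S \<union> T" and agree: "\<And>e x. e \<in> E \<Longrightarrow> x \<in> ends e \<Longrightarrow> x \<in> X \<union> Vx \<Longrightarrow> W e = W' e" for X I Vx W W'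
  proof -
    have "W (oe u) = W' (oe u)" if "u \<in> X" for u
      using that XST oe by (intro agree[of _ u]) blast+
    moreover have "restr (incident E ends v) W = restr (incident E ends v) W'" if v: "v \<in> Vx" for v
      using agree[of _ v] v by (auto simp: restr_def incident_def fun_eq_iff)
    ultimately show ?thesis by (simp add: p_def)
  qed
  have "beta_entry S T V E ends c Tn IT IS = (\<Sum>w\<in>edge_assignments C c.
      (\<Sum>b\<in>edge_assignments ET c. p T IT (V \<inter> Tb) (\<lambda>e. w e + b e)) *
      (\<Sum>a\<in>edge_assignments ES c. p S IS (V \<inter> Sb) (\<lambda>e. w e + a e)))" for IT IS
  proof -
    have V: "V = (V \<inter> Tb) \<union> (V \<inter> Sb)" "(V \<inter> Tb) \<inter> (V \<inter> Sb) = {}" using ST by auto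
    have prod_V: "prod h V = prod h (V \<inter> Tb) * prod h (V \<inter> Sb)" for h :: "'v \<Rightarrow> complex"
      by (subst V(1), rule prod.union_disjoint) (use finite_sets V(2) in auto)
    have "beta_entry S T V E ends c Tn IT IS = (\<Sum>W\<in>edge_assignments E c.
        of_bool (\<forall>u\<in>S. W (oe u) = IS u) * of_bool (\<forall>u\<in>T. W (oe u) = IT u) *
        (\<Prod>v\<in>V. Tn v (restr (incident E ends v) W)))"
      unfolding beta_entry_def
      by (subst sum.inter_filter) (auto simp: finite_edge_assignments finite_sets intro!: sum.cong)
    also have "\<dots> = (\<Sum>W\<in>edge_assignments E c. p T IT (V \<inter> Tb) W * p S IS (V \<inter> Sb) W)"
      by (intro sum.cong refl) (simp add: p_def prod_V)
    also have "\<dots> = (\<Sum>w\<in>edge_assignments C c. \<Sum>a\<in>edge_assignments ES c. \<Sum>b\<in>edge_assignments ET c.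
        p T IT (V \<inter> Tb) (\<lambda>e. w e + (a e + b e)) * p S IS (V \<inter> Sb) (\<lambda>e. w e + (a e + b e)))"
      unfolding E 
      by (simp add: sum_edge_assignments_Un[OF fin(1) _ dj(1)] sum_edge_assignments_Un[OF fin(2,3) dj(2)] fin)
    also have "\<dots> = (\<Sum>w\<in>edge_assignments C c. \<Sum>a\<in>edge_assignments ES c. \<Sum>b\<in>edge_assignments ET c.
        p T IT (V \<inter> Tb) (\<lambda>e. w e + b e) * p S IS (V \<inter> Sb) (\<lambda>e. w e + a e))"
    proof (intro sum.cong refl arg_cong2[of _ _ _ _ "(*)"] p_cong)
      \<comment> \<open>An edge seen by the output factor has an end in \<open>Tb\<close>, so it is
        outside \<open>ES\<close> and \<open>a\<close> vanishes on it. The next case is the mirror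
        image.\<close>
      fix a e x assume "a \<in> edge_assignments ES c" "x \<in> ends e" "x \<in> T \<union> V \<inter> Tb"
      moreover from this have "e \<notin> ES" using ST by (auto simp: ES_def)
      ultimately have "a e = 0" by (simp add: edge_assignments_def)
      then show "w e + (a e + b e) = w e + b e" for w b by simp
    next
      fix b e x assume "b \<in> edge_assignments ET c" "x \<in> ends e" "x \<in> S \<union> V \<inter> Sb"
      moreover from this have "e \<notin> ET" using ST by (auto simp: ET_def)
      ultimately have "b e = 0" by (simp add: edge_assignments_def)
      then show "w e + (a e + b e) = w e + a e" for w a by simp
    qed auto
    also have "\<dots> = (\<Sum>w\<in>edge_assignments C c.
      (\<Sum>b\<in>edge_assignments ET c. p T IT (V \<inter> Tb) (\<lambda>e. w e + b e)) *
      (\<Sum>a\<in>edge_assignments ES c. p S IS (V \<inter> Sb) (\<lambda>e. w e + a e)))"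
      by (subst sum.swap) (simp add: sum_product)
    finally show ?thesis .
  qed
  then show ?thesis by (rule that)
qed

lemma EE_le_ln_cut:
  assumes C: "is_edge_cut S T V E ends C" and nz: "beta_nonzero S T V E ends c Tn"
  shows "EE S T V E ends c Tn \<le> ln (real (\<Prod>e\<in>C. c e))"
proof -
  obtain f g where fg: "\<And>IT IS. beta_entry S T V E ends c Tn IT IS =
    (\<Sum>w\<in>edge_assignments C c. f IT w * g w IS)"
    using beta_factorises[OF C] by blast
  have CE: "C \<subseteq> E" using C by (auto simp: is_edge_cut_def)
  then have fC: "finite C" using finite_sets finite_subset by blast
  let ?M = "beta_matrix S T V E ends c Tn" and ?K = "edge_assignments C c"
  have M: "?M = fun_mat RT ?K f * fun_mat ?K RS g"
    unfolding beta_matrix_eq fun_mat_mult[OF finite_edge_assignments[OF fC]] fg ..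
  have "mat_trace (?M * mat_adjoint ?M) \<noteq> 0"
    using nz fun_mat_nonzero_trace[OF finite_RT finite_RS]
    unfolding beta_nonzero_def beta_matrix_eq by blast
  moreover have "card ?K = (\<Prod>e\<in>C. c e)" by (rule card_edge_assignments[OF fC])
  moreover have "(\<Prod>e\<in>C. c e) > 0" using c_pos CE by (intro prod_pos) auto
  ultimately show ?thesis
    unfolding EE_def Let_def
    using von_neumann_entropy_le_ln_rank[OF fun_mat_carrier fun_mat_carrier M refl] by simp
qed

lemma cuts_finite: "finite {C. is_edge_cut S T V E ends C}"
  by (rule finite_subset[of _ "Pow E"]) (use finite_sets in \<open>auto simp: is_edge_cut_def\<close>)

lemma cuts_nonempty: "\<exists>C. is_edge_cut S T V E ends C"
  unfolding is_edge_cut_def nodes_def using disjoint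
  by (intro exI[of _ "{e \<in> E. \<exists>x\<in>ends e. \<exists>y\<in>ends e. x \<in> S \<and> y \<in> T \<union> V}"]
      exI[of _ S] exI[of _ "T \<union> V"]) auto

lemma QMC_attained:
  obtains C where "is_edge_cut S T V E ends C" "QMC S T V E ends c = (\<Prod>e\<in>C. c e)"
proof -
  have eq: "{\<Prod>e\<in>C. c e | C. is_edge_cut S T V E ends C} = prod c ` {C. is_edge_cut S T V E ends C}"
    by auto
  have "QMC S T V E ends c \<in> prod c ` {C. is_edge_cut S T V E ends C}"
    unfolding QMC_def eq using cuts_finite cuts_nonempty by (intro Min_in) auto
  then show ?thesis using that by auto
qed

lemma QMC_le: "is_edge_cut S T V E ends C \<Longrightarrow> QMC S T V E ends c \<le> (\<Prod>e\<in>C. c e)"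
  unfolding QMC_def using cuts_finite by (intro Min_le) (auto simp: setcompr_eq_image)

lemma EE_le_ln_QMC:
  "beta_nonzero S T V E ends c Tn \<Longrightarrow> EE S T V E ends c Tn \<le> ln (real (QMC S T V E ends c))"
  using EE_le_ln_cut QMC_attained by metis

end

section \<open>Menger's theorem by uncrossing tight sets\<close>

text \<open>The last two assumptions make \<open>m\<close> the exact minimum cut of a directed graph
  with unit capacities. That it is attained serves to show that arcs from \<open>S\<close> straight
  to \<open>T\<close> are all kept.\<close>

locale min_cut_network =
  fixes A :: "'a set" and src tgt :: "'a \<Rightarrow> 'v" and S T V :: "'v set" and m :: nat
  assumes finite: "finite A" "finite S" "finite V"
    and disjoint: "S \<inter> T = {}" "S \<inter> V = {}" "T \<inter> V = {}"
    and arcs: "\<And>a. a \<in> A \<Longrightarrow> src a \<in> S \<union> T \<union> V" "\<And>a. a \<in> A \<Longrightarrow> tgt a \<in> S \<union> T \<union> V"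
    and cut_ge: "\<And>X. S \<subseteq> X \<Longrightarrow> X \<subseteq> S \<union> V \<Longrightarrow> m \<le> card {a \<in> A. src a \<in> X \<and> tgt a \<notin> X}"
    and cut_attained: "\<exists>X. S \<subseteq> X \<and> X \<subseteq> S \<union> V \<and> card {a \<in> A. src a \<in> X \<and> tgt a \<notin> X} = m"
begin

definition separating :: "'v set \<Rightarrow> bool" where
  "separating X \<longleftrightarrow> S \<subseteq> X \<and> X \<subseteq> S \<union> V"

definition leaving :: "'a set \<Rightarrow> 'v set \<Rightarrow> 'a set" where
  "leaving D X = {a \<in> D. src a \<in> X \<and> tgt a \<notin> X}"

definition m_connected :: "'a set \<Rightarrow> bool" where
  "m_connected D \<longleftrightarrow> D \<subseteq> A \<and> (\<forall>X. separating X \<longrightarrow> m \<le> card (leaving D X))"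

lemma minimal_m_connected_exists:
  "\<exists>D. m_connected D \<and> (\<forall>a\<in>D. \<not> m_connected (D - {a}))"
proof -
  have "m_connected A"
    using cut_ge by (auto simp: m_connected_def separating_def leaving_def)
  moreover have "finite {D. m_connected D}"
    using finite(1) by (rule finite_subset[rotated, OF finite_Pow_iff[THEN iffD2]]) (auto simp: m_connected_def)
  ultimately obtain D where D: "m_connected D" "\<And>D'. m_connected D' \<Longrightarrow> D' \<subseteq> D \<Longrightarrow> D' = D"
    using finite_has_minimal[of "{D. m_connected D}"] by blast
  then show ?thesis by (metis Diff_subset Diff_iff insertI1)
qed

end

locale minimal_network = min_cut_network A src tgt S T V m
  for A :: "'a set" and src tgt :: "'a \<Rightarrow> 'v" and S T V :: "'v set" and m :: nat +
  fixes D :: "'a set"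
  assumes conn: "m_connected D" and minimal: "\<And>a. a \<in> D \<Longrightarrow> \<not> m_connected (D - {a})"
begin

section \<open>Tight sets and uncrossing\<close>

definition tight :: "'v set \<Rightarrow> bool" where
  "tight X \<longleftrightarrow> separating X \<and> card (leaving D X) = m"

lemma D_subset: "D \<subseteq> A" and finite_D: "finite D"
  using conn finite(1) finite_subset by (auto simp: m_connected_def)

lemma leaving_finite [simp]: "finite (leaving D X)"
  using finite_D by (simp add: leaving_def)

lemma leaving_ge: "separating X \<Longrightarrow> m \<le> card (leaving D X)"
  using conn by (auto simp: m_connected_def)

text \<open>Deleting \<open>a\<close> brings some cut below \<open>m\<close>. That cut had at least
  \<open>m\<close> arcs and lost at most one, so it was tight and \<open>a\<close> crosses
  it.\<close>

lemma tight_crossed: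
  assumes a: "a \<in> D"
  obtains X where "tight X" "src a \<in> X" "tgt a \<notin> X"
proof -
  obtain X where X: "separating X" "card (leaving (D - {a}) X) < m"
    using minimal[OF a] D_subset unfolding m_connected_def by fastforce
  have eq: "leaving (D - {a}) X = leaving D X - {a}" by (auto simp: leaving_def)
  have "a \<in> leaving D X" using X leaving_ge[OF X(1)] unfolding eq by (cases "a \<in> leaving D X") auto
  moreover from this have "card (leaving D X) = m"
    using X leaving_ge[OF X(1)] unfolding eq by simp
  ultimately show ?thesis using X that by (auto simp: tight_def leaving_def)
qed

lemma arc_not_to_S: "a \<in> D \<Longrightarrow> tgt a \<notin> S"
  by (erule tight_crossed) (auto simp: tight_def separating_def)

lemma arc_not_from_T: "a \<in> D \<Longrightarrow> src a \<notin> T"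
  using disjoint by (elim tight_crossed) (auto simp: tight_def separating_def)

text \<open>Holds arc by arc, by the positions of the two ends. Keeping the arcs from
  \<open>X - Y\<close> to \<open>Y - X\<close> on the left is what later excludes such arcs between
  tight sets.\<close>

lemma leaving_submodular:
  "card (leaving D (X \<inter> Y)) + card (leaving D (X \<union> Y)) + card {a \<in> D. src a \<in> X - Y \<and> tgt a \<in> Y - X}
    \<le> card (leaving D X) + card (leaving D Y)"
proof -
  have c: "card {a \<in> D. P a} = (\<Sum>a\<in>D. if P a then 1 else 0)" for P
    using finite_D by (simp add: sum.If_cases Int_def)
  show ?thesis
    unfolding leaving_def c sum.distrib[symmetric] by (rule sum_mono) auto
qed

lemma separating_Int_Un:
  "separating X \<Longrightarrow> separating Y \<Longrightarrow> separating (X \<inter> Y)"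
  "separating X \<Longrightarrow> separating Y \<Longrightarrow> separating (X \<union> Y)"
  by (auto simp: separating_def)

text \<open>The cuts of the intersection and the union have at least \<open>m\<close> arcs each,
  while the two tight cuts provide only \<open>2 * m\<close> in total. So equality holds throughout
  and the extra term vanishes.\<close>

lemma tight_uncross:
  assumes "tight X" "tight Y"
  shows "tight (X \<inter> Y)" "tight (X \<union> Y)" "a \<in> D \<Longrightarrow> src a \<in> X - Y \<Longrightarrow> tgt a \<notin> Y - X"
proof -
  have s: "separating (X \<inter> Y)" "separating (X \<union> Y)"
    using assms separating_Int_Un by (auto simp: tight_def)
  let ?B = "{a \<in> D. src a \<in> X - Y \<and> tgt a \<in> Y - X}"
  have "card (leaving D (X \<inter> Y)) = m \<and> card (leaving D (X \<union> Y)) = m \<and> card ?B = 0"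
    using leaving_submodular[of X Y] leaving_ge[OF s(1)] leaving_ge[OF s(2)] assms
    by (auto simp: tight_def)
  moreover have "finite ?B" using finite_D by simp
  ultimately show "tight (X \<inter> Y)" "tight (X \<union> Y)" "a \<in> D \<Longrightarrow> src a \<in> X - Y \<Longrightarrow> tgt a \<notin> Y - X"
    using s by (auto simp: tight_def)
qed

lemma tight_Union: "finite F \<Longrightarrow> F \<noteq> {} \<Longrightarrow> (\<And>X. X \<in> F \<Longrightarrow> tight X) \<Longrightarrow> tight (\<Union>F)"
  by (induction F rule: finite_ne_induct) (auto intro: tight_uncross)

lemma tight_Inter: "finite F \<Longrightarrow> F \<noteq> {} \<Longrightarrow> (\<And>X. X \<in> F \<Longrightarrow> tight X) \<Longrightarrow> tight (\<Inter>F)"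
  by (induction F rule: finite_ne_induct) (auto intro: tight_uncross)

lemma finite_tight: "finite {X. tight X \<and> P X}"
  by (rule finite_subset[of _ "Pow (S \<union> V)"]) (use finite in \<open>auto simp: tight_def separating_def\<close>)

text \<open>If \<open>a\<close> entered \<open>Y\<close> from outside, then with the tight set
  \<open>X\<close> that \<open>a\<close> crosses it would run from \<open>X - Y\<close> to
  \<open>Y - X\<close>, which uncrossing excludes.\<close>

lemma tight_down_closed:
  assumes Y: "tight Y" and a: "a \<in> D" "tgt a \<in> Y"
  shows "src a \<in> Y"
proof (rule ccontr)
  assume n: "src a \<notin> Y"
  obtain X where "tight X" "src a \<in> X" "tgt a \<notin> X" using tight_crossed[OF a(1)] .
  with tight_uncross(3)[of X Y a] Y a n show False by blast
qed

text \<open>Strictly increasing along the arcs of \<open>D\<close>; in particular \<open>D\<close> is acyclic and uses no strand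
  in both directions.\<close>

definition height :: "'v \<Rightarrow> nat" where
  "height v = card {X. tight X \<and> v \<notin> X}"

lemma height_less: assumes "a \<in> D" shows "height (src a) < height (tgt a)"
  unfolding height_def
proof (rule psubset_card_mono[OF finite_tight])
  obtain X where "tight X" "src a \<in> X" "tgt a \<notin> X" using tight_crossed[OF assms] .
  \<comment> \<open>Down-closure gives the inclusion; the tight set crossed by \<open>a\<close>
    makes it strict.\<close>
  then show "{X. tight X \<and> src a \<notin> X} \<subset> {X. tight X \<and> tgt a \<notin> X}"
    using tight_down_closed[OF _ assms] by blast
qed

text \<open>Compare the union of the tight sets avoiding \<open>v\<close> with the set obtained by adding \<open>v\<close>; dually,
  remove \<open>v\<close> from the intersection of the tight sets containing it.\<close>

lemma card_in_le_card_out: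
  assumes v: "v \<in> V"
  shows "card {a \<in> D. tgt a = v} \<le> card {a \<in> D. src a = v}"
proof (cases "{a \<in> D. tgt a = v} = {}")
  case False
  let ?F = "{X. tight X \<and> v \<notin> X}"
  define B where "B = \<Union>?F"
  obtain a where "a \<in> D" "tgt a = v" using False by blast
  then obtain X where "X \<in> ?F" using tight_crossed by blast
  then have B: "tight B"
    unfolding B_def by (intro tight_Union) (use finite_tight in auto)
  have vB: "v \<notin> B" by (auto simp: B_def)
  \<comment> \<open>Each arc into \<open>v\<close> crosses a tight set avoiding \<open>v\<close>;
    that set is part of \<open>B\<close>, so the arc leaves \<open>B\<close>.\<close>
  have in_sub: "{a \<in> D. tgt a = v} \<subseteq> leaving D B"
  proof
    fix a assume a: "a \<in> {a \<in> D. tgt a = v}"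
    then obtain X where "tight X" "src a \<in> X" "tgt a \<notin> X" using tight_crossed by blast
    with a vB show "a \<in> leaving D B" by (auto simp: leaving_def B_def)
  qed
  have "separating (insert v B)" using B v by (auto simp: tight_def separating_def)
  then have "m \<le> card (leaving D (insert v B))" by (rule leaving_ge)
  \<comment> \<open>Adding \<open>v\<close> loses the arcs into \<open>v\<close> and gains at most
    those out of \<open>v\<close>; as \<open>B\<close> has just \<open>m\<close> leaving arcs, the
    loss cannot exceed the gain.\<close>
  also have "\<dots> \<le> card ((leaving D B - {a \<in> D. tgt a = v}) \<union> {a \<in> D. src a = v})"
    by (rule card_mono) (use finite_D in \<open>auto simp: leaving_def\<close>)
  also have "\<dots> \<le> card (leaving D B - {a \<in> D. tgt a = v}) + card {a \<in> D. src a = v}"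
    by (rule card_Un_le)
  also have "card (leaving D B - {a \<in> D. tgt a = v}) = m - card {a \<in> D. tgt a = v}"
    using in_sub B finite_D by (subst card_Diff_subset) (auto simp: tight_def)
  finally have "m \<le> m - card {a \<in> D. tgt a = v} + card {a \<in> D. src a = v}" .
  moreover have "card {a \<in> D. tgt a = v} \<le> m"
    using card_mono[OF _ in_sub] B by (simp add: tight_def)
  ultimately show ?thesis by linarith
next
  case True
  show ?thesis unfolding True by simp
qed

lemma card_out_le_card_in:
  assumes v: "v \<in> V"
  shows "card {a \<in> D. src a = v} \<le> card {a \<in> D. tgt a = v}"
proof (cases "{a \<in> D. src a = v} = {}")
  case False
  let ?F = "{X. tight X \<and> v \<in> X}"
  define B where "B = \<Inter>?F"
  obtain a where "a \<in> D" "src a = v" using False by blast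
  then obtain X where "X \<in> ?F" using tight_crossed by blast
  then have B: "tight B"
    unfolding B_def by (intro tight_Inter) (use finite_tight in auto)
  have vB: "v \<in> B" by (auto simp: B_def)
  have out_sub: "{a \<in> D. src a = v} \<subseteq> leaving D B"
  proof
    fix a assume a: "a \<in> {a \<in> D. src a = v}"
    then obtain X where "tight X" "src a \<in> X" "tgt a \<notin> X" using tight_crossed by blast
    with a vB show "a \<in> leaving D B" by (auto simp: leaving_def B_def)
  qed
  have "separating (B - {v})" using B v disjoint by (auto simp: tight_def separating_def)
  then have "m \<le> card (leaving D (B - {v}))" by (rule leaving_ge)
  also have "\<dots> \<le> card ((leaving D B - {a \<in> D. src a = v}) \<union> {a \<in> D. tgt a = v})"
    by (rule card_mono) (use finite_D in \<open>auto simp: leaving_def\<close>)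
  also have "\<dots> \<le> card (leaving D B - {a \<in> D. src a = v}) + card {a \<in> D. tgt a = v}"
    by (rule card_Un_le)
  also have "card (leaving D B - {a \<in> D. src a = v}) = m - card {a \<in> D. src a = v}"
    using out_sub B finite_D by (subst card_Diff_subset) (auto simp: tight_def)
  finally have "m \<le> m - card {a \<in> D. src a = v} + card {a \<in> D. tgt a = v}" .
  moreover have "card {a \<in> D. src a = v} \<le> m"
    using card_mono[OF _ out_sub] B by (simp add: tight_def)
  ultimately show ?thesis by linarith
next
  case True
  show ?thesis unfolding True by simp
qed

lemma conservation:
  assumes "v \<in> V"
  obtains p where "bij_betw p {a \<in> D. src a = v} {a \<in> D. tgt a = v}"
  using finite_same_card_bij[of "{a \<in> D. src a = v}" "{a \<in> D. tgt a = v}"] finite_D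
    card_in_le_card_out[OF assms] card_out_le_card_in[OF assms] by auto

section \<open>Path labels\<close>

definition sources :: "'a set" where
  "sources = {a \<in> D. src a \<in> S}"

definition down_closed :: "'v set \<Rightarrow> bool" where
  "down_closed X \<longleftrightarrow> separating X \<and> (\<forall>a\<in>D. tgt a \<in> X \<longrightarrow> src a \<in> X)"

text \<open>The label of an arc is the first arc of the path through it. The induction adds the vertices
  in order of height and routes the incoming labels to the outgoing arcs.\<close>

lemma closed_labelling:
  "down_closed X \<Longrightarrow> \<exists>l. (\<forall>a\<in>sources. l a = a) \<and> bij_betw l (leaving D X) sources \<and>
     (\<forall>v\<in>X \<inter> V. l ` {a \<in> D. src a = v} \<subseteq> l ` {a \<in> D. tgt a = v})"
proof (induction "card (X \<inter> V)" arbitrary: X)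
  case 0
  then have "X \<inter> V = {}" using finite by auto
  moreover from this have "X = S" using 0 by (auto simp: down_closed_def separating_def)
  \<comment> \<open>No arc enters \<open>S\<close>, so the arcs leaving \<open>S\<close> are exactly
    the sources, and each is its own label.\<close>
  ultimately show ?case
    using arc_not_to_S by (intro exI[of _ "\<lambda>a. a"]) (auto simp: leaving_def sources_def bij_betw_def)
next
  case (Suc k)
  then have ne: "X \<inter> V \<noteq> {}" by auto
  have "Max (height ` (X \<inter> V)) \<in> height ` (X \<inter> V)"
    using ne finite by (intro Max_in) auto
  \<comment> \<open>Removing a highest vertex keeps the set down-closed, because every arc out of it
    already leaves \<open>X\<close>.\<close>
  then obtain v where v: "v \<in> X \<inter> V" "height v = Max (height ` (X \<inter> V))"
    by (metis imageE)
  have v_max: "height w \<le> height v" if "w \<in> X \<inter> V" for w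
    using that v finite by simp
  have out_v: "tgt a \<notin> X" if "a \<in> D" "src a = v" for a
  proof
    assume "tgt a \<in> X"
    with that have "tgt a \<in> X \<inter> V"
      using arc_not_to_S Suc.prems by (auto simp: down_closed_def separating_def)
    from v_max[OF this] height_less[OF that(1)] that show False by simp
  qed
  have "v \<notin> S" using v disjoint by auto
  let ?X = "X - {v}"
  have "separating ?X"
    using Suc.prems \<open>v \<notin> S\<close> by (auto simp: down_closed_def separating_def)
  moreover have "src a \<in> ?X" if "a \<in> D" "tgt a \<in> ?X" for a
    using that Suc.prems out_v[of a] by (auto simp: down_closed_def)
  ultimately have "down_closed ?X" by (simp add: down_closed_def)
  moreover have "k = card (?X \<inter> V)"
  proof -
    have "?X \<inter> V = X \<inter> V - {v}" by auto
    then show ?thesis using Suc.hyps(2) v finite by simp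
  qed
  ultimately have "\<exists>l. (\<forall>a\<in>sources. l a = a) \<and> bij_betw l (leaving D ?X) sources \<and>
     (\<forall>v\<in>?X \<inter> V. l ` {a \<in> D. src a = v} \<subseteq> l ` {a \<in> D. tgt a = v})"
    using Suc.hyps(1)[of ?X] by simp
  then obtain l where l: "\<forall>a\<in>sources. l a = a" "bij_betw l (leaving D ?X) sources"
    "\<forall>w\<in>?X \<inter> V. l ` {a \<in> D. src a = w} \<subseteq> l ` {a \<in> D. tgt a = w}"
    by (elim exE conjE)
  obtain p where p: "bij_betw p {a \<in> D. src a = v} {a \<in> D. tgt a = v}"
    using conservation[of v] v by auto
  let ?in = "{a \<in> D. tgt a = v}" and ?out = "{a \<in> D. src a = v}"
  \<comment> \<open>\<open>p\<close> matches each outgoing arc of \<open>v\<close> with an incoming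
    one, whose label it inherits; all other labels are kept.\<close>
  define l' where "l' a = (if src a = v then l (p a) else l a)" for a
  have in_src: "src a \<in> X" "src a \<noteq> v" if "a \<in> D" "tgt a = v" for a
  proof -
    show "src a \<in> X" using that Suc.prems v(1) by (simp add: down_closed_def)
    show "src a \<noteq> v" using that height_less[of a] by auto
  qed
  have in_sub: "?in \<subseteq> leaving D ?X"
    using in_src by (auto simp: leaving_def)
  \<comment> \<open>Putting \<open>v\<close> back exchanges its incoming arcs for its outgoing ones,
    so the bijection with \<open>sources\<close> has to be patched on these alone.\<close>
  have eq: "leaving D X = (leaving D ?X - ?in) \<union> ?out"
    using v(1) by (auto simp: leaving_def dest: out_v)
  have inj: "inj_on l (leaving D ?X)" using l(2) by (simp add: bij_betw_def)
  have "bij_betw (l \<circ> p) ?out (l ` ?in)"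
    by (rule bij_betw_trans[OF p]) (use inj in_sub inj_on_subset in \<open>auto simp: bij_betw_def\<close>)
  then have 1: "bij_betw l' ?out (l ` ?in)"
    by (subst bij_betw_cong[of _ _ "l \<circ> p"]) (auto simp: l'_def)
  have "bij_betw l (leaving D ?X - ?in) (sources - l ` ?in)"
    using l(2) in_sub inj inj_on_image_set_diff[OF inj, of "leaving D ?X" ?in]
    by (auto simp: bij_betw_def intro: inj_on_subset)
  then have 2: "bij_betw l' (leaving D ?X - ?in) (sources - l ` ?in)"
    by (subst bij_betw_cong[of _ _ l]) (auto simp: l'_def leaving_def)
  have "bij_betw l' (leaving D X) (sources - l ` ?in \<union> l ` ?in)"
    unfolding eq by (rule bij_betw_combine[OF 2 1]) auto
  moreover have "l ` ?in \<subseteq> sources" using l(2) in_sub by (auto simp: bij_betw_def)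
  then have "sources - l ` ?in \<union> l ` ?in = sources" by auto
  ultimately have "bij_betw l' (leaving D X) sources" by simp
  moreover have "\<forall>a\<in>sources. l' a = a"
    using l(1) \<open>v \<notin> S\<close> by (auto simp: l'_def sources_def)
  moreover have "l' ` {a \<in> D. src a = w} \<subseteq> l' ` {a \<in> D. tgt a = w}" if w: "w \<in> X \<inter> V" for w
  proof (cases "w = v")
    case True
    have "l' ` ?in = l ` ?in" using in_src by (auto simp: l'_def image_iff)
    moreover have "l' ` ?out = l ` ?in" using 1 by (simp add: bij_betw_def)
    ultimately show ?thesis using True by simp
  next
    case False
    have "l' ` {a \<in> D. src a = w} = l ` {a \<in> D. src a = w}" using False by (auto simp: l'_def image_iff)
    moreover have "l' ` {a \<in> D. tgt a = w} = l ` {a \<in> D. tgt a = w}"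
      using out_v w by (intro image_cong) (auto simp: l'_def)
    ultimately show ?thesis using bspec[OF l(3), of w] w False by simp
  qed
  ultimately show ?case by blast
qed

text \<open>A tight set is down-closed, so the labelling matches its \<open>m\<close> leaving arcs
  with the sources. If \<open>D\<close> is empty no arc supplies a tight set, but the cut of
  \<open>S\<close> then forces \<open>m = 0\<close>.\<close>

lemma card_sources: "card sources = m"
proof (cases "D = {}")
  case True
  have "separating S" by (auto simp: separating_def)
  then have "m \<le> card (leaving D S)" by (rule leaving_ge)
  moreover have "leaving D S = {}" "sources = {}"
    unfolding leaving_def sources_def using True by simp_all
  ultimately show ?thesis by simp
next
  case False
  then obtain X where X: "tight X" using tight_crossed by blast
  then have "down_closed X" using tight_down_closed by (auto simp: down_closed_def tight_def)
  with closed_labelling obtain l where "bij_betw l (leaving D X) sources" by blast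
  from bij_betw_same_card[OF this] X show ?thesis by (simp add: tight_def)
qed

lemma saturated: assumes "a \<in> A" "src a \<in> S" "tgt a \<in> T" shows "a \<in> D"
proof -
  obtain X where X: "separating X" "card (leaving A X) = m"
    using cut_attained by (auto simp: separating_def leaving_def)
  have "leaving D X \<subseteq> leaving A X" using D_subset by (auto simp: leaving_def)
  moreover have "finite (leaving A X)" using finite by (simp add: leaving_def)
  ultimately have "leaving D X = leaving A X"
    using leaving_ge[OF X(1)] X(2) by (intro card_subset_eq) (auto simp: card_mono antisym)
  moreover have "a \<in> leaving A X"
    using X(1) assms disjoint by (auto simp: leaving_def separating_def)
  ultimately show ?thesis by (auto simp: leaving_def)
qed

text \<open>The last property replaces explicit paths: whatever is preserved from an arc to a
  successor with the same label is constant along the path, back to its first arc.\<close>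

lemma labelling:
  obtains l where "\<And>a. a \<in> sources \<Longrightarrow> l a = a" "\<And>a. a \<in> D \<Longrightarrow> l a \<in> sources"
    "l ` {a \<in> D. tgt a \<in> T} = sources"
    "\<And>(f :: 'a \<Rightarrow> 'b) a. (\<And>a b. a \<in> D \<Longrightarrow> b \<in> D \<Longrightarrow> tgt a = src b \<Longrightarrow> l a = l b \<Longrightarrow> f a = f b) \<Longrightarrow>
      a \<in> D \<Longrightarrow> f a = f (l a)"
proof -
  have "down_closed (S \<union> V)"
    using arc_not_from_T D_subset arcs by (auto simp: down_closed_def separating_def)
  from closed_labelling[OF this] obtain l where
    l: "\<forall>a\<in>sources. l a = a" "bij_betw l (leaving D (S \<union> V)) sources"
    and l_out: "\<forall>v\<in>(S \<union> V) \<inter> V. l ` {a \<in> D. src a = v} \<subseteq> l ` {a \<in> D. tgt a = v}"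
    by (elim exE conjE)
  have step: "a \<in> sources \<or> (\<exists>b\<in>D. tgt b = src a \<and> l b = l a)" if "a \<in> D" for a
  proof (cases "src a \<in> S")
    case False
    then have "src a \<in> V" using arc_not_from_T[OF that] arcs(1)[of a] that D_subset by auto
    then have "l ` {b \<in> D. src b = src a} \<subseteq> l ` {b \<in> D. tgt b = src a}"
      using l_out by simp
    then have "l a \<in> l ` {b \<in> D. tgt b = src a}" using that by blast
    then obtain b where "b \<in> D" "tgt b = src a" "l a = l b" by auto
    then show ?thesis by auto
  qed (use that in \<open>auto simp: sources_def\<close>)
  \<comment> \<open>Induction back along the path: a predecessor with the same label starts at a
    smaller height.\<close>
  have ind: "P a" if "a \<in> D" "\<And>a. a \<in> sources \<Longrightarrow> P a"
    "\<And>a b. a \<in> D \<Longrightarrow> b \<in> D \<Longrightarrow> tgt b = src a \<Longrightarrow> l b = l a \<Longrightarrow> P b \<Longrightarrow> P a" for P a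
    using that(1)
  proof (induction "height (src a)" arbitrary: a rule: less_induct)
    case less
    from step[OF less.prems] show ?case
    proof
      assume "\<exists>b\<in>D. tgt b = src a \<and> l b = l a"
      then obtain b where b: "b \<in> D" "tgt b = src a" "l b = l a" by auto
      then have "P b" using less.hyps[of b] height_less[of b] by simp
      then show ?thesis using that(3)[OF less.prems b] by simp
    qed (rule that(2))
  qed
  have "l a \<in> sources" if "a \<in> D" for a
    using that by (rule ind) (auto simp: l(1))
  moreover have "leaving D (S \<union> V) = {a \<in> D. tgt a \<in> T}"
    using arcs D_subset arc_not_from_T disjoint by (fastforce simp: leaving_def)
  then have "l ` {a \<in> D. tgt a \<in> T} = sources" using l(2) by (simp add: bij_betw_def)
  moreover have "f a = f (l a)" if f: "\<And>a b. a \<in> D \<Longrightarrow> b \<in> D \<Longrightarrow> tgt a = src b \<Longrightarrow> l a = l b \<Longrightarrow> f a = f b"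
    and a: "a \<in> D" for f :: "'a \<Rightarrow> 'b" and a
  proof (rule ind[OF a])
    show "f a = f (l a)" if "a \<in> sources" for a using l(1) that by simp
    show "f a = f (l a)" if "a \<in> D" "b \<in> D" "tgt b = src a" "l b = l a" "f b = f (l b)" for a b
      using f[of b a] that by simp
  qed
  ultimately show ?thesis using l(1) by (intro that[of l]) simp_all
qed

end

section \<open>Tensors routed along disjoint paths\<close>

type_synonym ('e, 'v) strand_arc = "'e \<times> nat \<times> 'v \<times> 'v"

abbreviation arc_edge :: "('e, 'v) strand_arc \<Rightarrow> 'e" where "arc_edge a \<equiv> fst a"
abbreviation arc_strand :: "('e, 'v) strand_arc \<Rightarrow> nat" where "arc_strand a \<equiv> fst (snd a)"
abbreviation arc_src :: "('e, 'v) strand_arc \<Rightarrow> 'v" where "arc_src a \<equiv> fst (snd (snd a))"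
abbreviation arc_tgt :: "('e, 'v) strand_arc \<Rightarrow> 'v" where "arc_tgt a \<equiv> snd (snd (snd a))"

lemma edge_assignments_off: "W \<in> edge_assignments F c \<Longrightarrow> e \<notin> F \<Longrightarrow> W e = 0"
  by (simp add: edge_assignments_def)

text \<open>For distinct \<open>x\<close> and \<open>x'\<close> the images are disjoint, so no
  \<open>r\<close> has both counts nonzero; for \<open>x = x'\<close> the map is injective in
  \<open>t\<close>, so the counts are 0 or 1. This computes the Gram matrices of the two factors of
  the contraction.\<close>

lemma sum_card_fibres_orthogonal:
  assumes fin: "finite R" "finite F"
    and g: "\<And>t. t \<in> F \<Longrightarrow> g x t \<in> R" "\<And>t. t \<in> F \<Longrightarrow> g x' t \<in> R"
    and inj: "\<And>t t'. t \<in> F \<Longrightarrow> t' \<in> F \<Longrightarrow> g x t = g x' t' \<longleftrightarrow> x = x' \<and> t = t'"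
  shows "(\<Sum>r\<in>R. of_nat (card {t \<in> F. g x t = r}) * of_nat (card {t \<in> F. g x' t = r})) =
    (if x = x' then of_nat (card F) else 0 :: complex)"
proof -
  have c: "of_nat (card {t \<in> F. P t}) = (\<Sum>t\<in>F. of_bool (P t) :: complex)" for P
    using fin by (simp add: of_bool_def sum.If_cases Int_def)
  have "(\<Sum>r\<in>R. of_nat (card {t \<in> F. g x t = r}) * of_nat (card {t \<in> F. g x' t = r})) =
      (\<Sum>t\<in>F. \<Sum>t'\<in>F. \<Sum>r\<in>R. of_bool (g x t = r) * of_bool (g x' t' = r) :: complex)"
    unfolding c sum_product by (subst sum.swap, rule sum.cong[OF refl], rule sum.swap)
  also have "\<dots> = (\<Sum>t\<in>F. \<Sum>t'\<in>F. of_bool (x = x' \<and> t = t'))"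
  proof (intro sum.cong refl)
    fix t t' assume t: "t \<in> F" "t' \<in> F"
    have "(\<Sum>r\<in>R. of_bool (g x t = r) * of_bool (g x' t' = r) :: complex) =
        (\<Sum>r\<in>R. if r = g x t then of_bool (g x' t' = g x t) else 0)"
      by (intro sum.cong) auto
    also have "\<dots> = of_bool (x = x' \<and> t = t')"
      using fin g(1) t inj[OF t] by (auto simp: eq_commute)
    finally show "(\<Sum>r\<in>R. of_bool (g x t = r) * of_bool (g x' t' = r) :: complex) =
        of_bool (x = x' \<and> t = t')" .
  qed
  also have "\<dots> = (if x = x' then of_nat (card F) else 0)"
    using fin by (simp add: of_bool_def sum.If_cases)
  finally show ?thesis .
qed

text \<open>The interface to the path system: at most one arc per strand, with \<open>l\<close>
  naming the path through an arc by its first arc in \<open>L\<close>. In \<open>l_propagate\<close>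
  the function will be the digit carried by an arc, and its hypothesis is restricted to heads in
  \<open>V\<close> because only these carry tensors.\<close>

locale routed_template = template S T V E ends c
  for S T V :: "'v set" and E :: "'e set" and ends :: "'e \<Rightarrow> 'v set" and c :: "'e \<Rightarrow> nat" +
  fixes d :: nat and k :: "'e \<Rightarrow> nat" and D :: "('e, 'v) strand_arc set"
    and l :: "('e, 'v) strand_arc \<Rightarrow> ('e, 'v) strand_arc" and L :: "('e, 'v) strand_arc set"
  assumes d_pos: "d > 0" and c_eq: "\<And>e. e \<in> E \<Longrightarrow> c e = d ^ k e"
    and D_arc: "\<And>a. a \<in> D \<Longrightarrow> arc_edge a \<in> E" "\<And>a. a \<in> D \<Longrightarrow> arc_strand a < k (arc_edge a)"
      "\<And>a. a \<in> D \<Longrightarrow> ends (arc_edge a) = {arc_src a, arc_tgt a}"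
    and D_unique: "\<And>a b. a \<in> D \<Longrightarrow> b \<in> D \<Longrightarrow> arc_edge a = arc_edge b \<Longrightarrow> arc_strand a = arc_strand b \<Longrightarrow> a = b"
    and tgt_notin_S: "\<And>a. a \<in> D \<Longrightarrow> arc_tgt a \<notin> S"
    and src_notin_T: "\<And>a. a \<in> D \<Longrightarrow> arc_src a \<notin> T"
    and saturated: "\<And>e i u w. e \<in> E \<Longrightarrow> i < k e \<Longrightarrow> u \<in> S \<Longrightarrow> w \<in> T \<Longrightarrow> ends e = {u, w} \<Longrightarrow> (e, i, u, w) \<in> D"
    and finite_L: "finite L" and L: "\<And>a. a \<in> L \<Longrightarrow> a \<in> D" "\<And>a. a \<in> L \<Longrightarrow> arc_src a \<in> S" "\<And>a. a \<in> L \<Longrightarrow> l a = a"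
    and l_in: "\<And>a. a \<in> D \<Longrightarrow> l a \<in> L"
    and l_onto: "\<And>b. b \<in> L \<Longrightarrow> \<exists>a\<in>D. arc_tgt a \<in> T \<and> l a = b"
    and l_propagate: "\<And>(f :: ('e, 'v) strand_arc \<Rightarrow> nat) a.
      (\<And>a b. a \<in> D \<Longrightarrow> b \<in> D \<Longrightarrow> arc_tgt a \<in> V \<Longrightarrow> arc_tgt a = arc_src b \<Longrightarrow> l a = l b \<Longrightarrow> f a = f b) \<Longrightarrow>
      a \<in> D \<Longrightarrow> f a = f (l a)"
begin

definition digits :: "'e \<Rightarrow> nat \<Rightarrow> nat \<Rightarrow> nat" where
  "digits e = (SOME f. bij_betw f {..<c e} (PiE {..<k e} (\<lambda>_. {..<d})))"

lemma digits_bij: assumes "e \<in> E" shows "bij_betw (digits e) {..<c e} (PiE {..<k e} (\<lambda>_. {..<d}))"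
proof -
  have "\<exists>f. bij_betw f {..<c e} (PiE {..<k e} (\<lambda>_. {..<d}))"
    by (rule finite_same_card_bij) (simp_all add: finite_PiE card_PiE c_eq[OF assms])
  then show ?thesis unfolding digits_def by (rule someI_ex)
qed

definition from_digits :: "'e \<Rightarrow> (nat \<Rightarrow> nat) \<Rightarrow> nat" where
  "from_digits e y = inv_into {..<c e} (digits e) (restrict y {..<k e})"

lemma from_digits:
  assumes e: "e \<in> E" and y: "\<And>i. i < k e \<Longrightarrow> y i < d"
  shows "from_digits e y < c e" "i < k e \<Longrightarrow> digits e (from_digits e y) i = y i"
proof -
  have y': "restrict y {..<k e} \<in> PiE {..<k e} (\<lambda>_. {..<d})" using y by auto
  show "from_digits e y < c e"
    using bij_betw_apply[OF bij_betw_inv_into[OF digits_bij[OF e]] y'] by (simp add: from_digits_def)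
  show "digits e (from_digits e y) i = y i" if "i < k e"
    using bij_betw_inv_into_right[OF digits_bij[OF e] y'] that by (simp add: from_digits_def)
qed

lemma from_digits_digits:
  assumes e: "e \<in> E" and n: "n < c e" and y: "\<And>i. i < k e \<Longrightarrow> digits e n i = y i"
  shows "from_digits e y = n"
proof -
  have "digits e n \<in> PiE {..<k e} (\<lambda>_. {..<d})"
    using bij_betw_apply[OF digits_bij[OF e]] n by simp
  then have "restrict y {..<k e} = digits e n"
    using y by (auto simp: fun_eq_iff PiE_def extensional_def)
  then show ?thesis
    using bij_betw_inv_into_left[OF digits_bij[OF e]] n by (simp add: from_digits_def)
qed

definition used :: "'e \<Rightarrow> nat \<Rightarrow> bool" where
  "used e i \<longleftrightarrow> (\<exists>a\<in>D. arc_edge a = e \<and> arc_strand a = i)"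

definition arc_of :: "'e \<Rightarrow> nat \<Rightarrow> ('e, 'v) strand_arc" where
  "arc_of e i = (THE a. a \<in> D \<and> arc_edge a = e \<and> arc_strand a = i)"

lemma arc_of: "a \<in> D \<Longrightarrow> arc_of (arc_edge a) (arc_strand a) = a"
  unfolding arc_of_def by (rule the_equality) (auto intro: D_unique)

lemma arc_of_used:
  assumes "used e i"
  shows "arc_of e i \<in> D" "arc_edge (arc_of e i) = e" "arc_strand (arc_of e i) = i"
  using assms arc_of unfolding used_def by auto

text \<open>Edges of \<open>SS\<close> and \<open>TT\<close> meet no vertex and belong to no path.
  Their indices become the free coordinates \<open>s\<close> and \<open>t\<close> below.\<close>

definition SS :: "'e set" where "SS = {e \<in> E. ends e \<subseteq> S}"
definition TT :: "'e set" where "TT = {e \<in> E. ends e \<subseteq> T}"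

lemma finite_SS: "finite SS" and finite_TT: "finite TT"
  using finite_sets by (auto simp: SS_def TT_def)

lemma SS_TT: "SS \<subseteq> E" "TT \<subseteq> E" "e \<in> SS \<Longrightarrow> e \<notin> TT"
  using ends(2)[of e] disjoint(1) unfolding SS_def TT_def by blast+

lemma arc_edge_notin: "a \<in> D \<Longrightarrow> arc_edge a \<notin> SS" "a \<in> D \<Longrightarrow> arc_edge a \<notin> TT"
  using D_arc(3) tgt_notin_S src_notin_T by (auto simp: SS_def TT_def)

lemma vertex_edge_notin:
  assumes "v \<in> V" "v \<in> ends e" shows "e \<notin> SS" "e \<notin> TT"
  using assms disjoint by (auto simp: SS_def TT_def)

section \<open>Assignments carried by paths\<close>

abbreviation "X \<equiv> edge_assignments L (\<lambda>_. d)"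
abbreviation "FS \<equiv> edge_assignments SS c"
abbreviation "FT \<equiv> edge_assignments TT c"

definition strand_value :: "(('e, 'v) strand_arc \<Rightarrow> nat) \<Rightarrow> 'e \<Rightarrow> nat \<Rightarrow> nat" where
  "strand_value x e i = (if used e i then x (l (arc_of e i)) else 0)"

lemma strand_value_less: "x \<in> X \<Longrightarrow> strand_value x e i < d"
  using d_pos l_in arc_of_used by (auto simp: strand_value_def edge_assignments_def)

definition glue :: "(('e, 'v) strand_arc \<Rightarrow> nat) \<Rightarrow> ('e \<Rightarrow> nat) \<Rightarrow> ('e \<Rightarrow> nat) \<Rightarrow> 'e \<Rightarrow> nat" where
  "glue x s t e = (if e \<in> SS then s e else if e \<in> TT then t e
     else if e \<in> E then from_digits e (strand_value x e) else 0)"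

lemma glue_digits:
  assumes "x \<in> X" "e \<in> E" "e \<notin> SS" "e \<notin> TT" "i < k e"
  shows "digits e (glue x s t e) i = strand_value x e i"
  using assms from_digits(2)[of e "strand_value x e" i] strand_value_less by (simp add: glue_def)

lemma glue_in:
  assumes "x \<in> X" "s \<in> FS" "t \<in> FT"
  shows "glue x s t \<in> edge_assignments E c"
  using assms from_digits(1)[OF _ strand_value_less] SS_TT
  by (auto simp: edge_assignments_def glue_def)

definition compatible :: "'v \<Rightarrow> ('e \<Rightarrow> nat) \<Rightarrow> bool" where
  "compatible v w \<longleftrightarrow>
     (\<forall>a\<in>D. \<forall>b\<in>D. arc_tgt a = v \<and> arc_src b = v \<and> l a = l b \<longrightarrow>
        digits (arc_edge a) (w (arc_edge a)) (arc_strand a) = digits (arc_edge b) (w (arc_edge b)) (arc_strand b)) \<and>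
     (\<forall>e\<in>E. v \<in> ends e \<longrightarrow> (\<forall>i<k e. \<not> used e i \<longrightarrow> digits e (w e) i = 0))"

text \<open>With entries 0 and 1 the contraction counts compatible assignments.\<close>

definition tensor :: "'v \<Rightarrow> ('e \<Rightarrow> nat) \<Rightarrow> complex" where
  "tensor v w = of_bool (compatible v w)"

lemma compatible_restr: "compatible v (restr (incident E ends v) W) \<longleftrightarrow> compatible v W"
proof -
  have "restr (incident E ends v) W e = W e" if "e \<in> E" "v \<in> ends e" for e
    using that by (simp add: restr_def incident_def)
  then show ?thesis
    using D_arc(1,3) unfolding compatible_def by (intro arg_cong2[of _ _ _ _ "(\<and>)"] ball_cong refl) auto
qed

lemma digits_glue_arc:
  assumes "x \<in> X" "a \<in> D"
  shows "digits (arc_edge a) (glue x s t (arc_edge a)) (arc_strand a) = x (l a)"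
  using glue_digits[OF assms(1), of "arc_edge a" "arc_strand a" s t] D_arc arc_edge_notin arc_of assms(2)
  by (auto simp: strand_value_def used_def)

lemma compatible_glue:
  assumes x: "x \<in> X" and v: "v \<in> V"
  shows "compatible v (glue x s t)"
proof -
  have "digits e (glue x s t e) i = 0" if "e \<in> E" "v \<in> ends e" "i < k e" "\<not> used e i" for e i
    using that glue_digits[OF x that(1)] vertex_edge_notin[OF v that(2)] by (simp add: strand_value_def)
  then show ?thesis using digits_glue_arc[OF x] by (simp add: compatible_def)
qed

lemma used_of_not_at_vertex:
  assumes e: "e \<in> E" "e \<notin> SS" "e \<notin> TT" "ends e \<inter> V = {}" and i: "i < k e"
  shows "used e i"
proof -
  have "ends e \<subseteq> S \<union> T" using ends(1)[OF e(1)] e(4) by auto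
  then obtain u w where u: "u \<in> ends e" "u \<in> S" and w: "w \<in> ends e" "w \<in> T"
    using e(1-3) by (auto simp: SS_def TT_def)
  have "finite (ends e)" using \<open>ends e \<subseteq> S \<union> T\<close> finite_sets finite_subset by blast
  moreover have "u \<noteq> w" using u w disjoint by auto
  ultimately have "ends e = {u, w}"
    using u w ends(3)[OF e(1)] by (intro card_seteq[symmetric]) auto
  from saturated[OF e(1) i u(2) w(2) this] show ?thesis by (force simp: used_def)
qed

lemma compatible_imp_glue:
  assumes W: "W \<in> edge_assignments E c" and comp: "\<And>v. v \<in> V \<Longrightarrow> compatible v W"
  obtains x s t where "x \<in> X" "s \<in> FS" "t \<in> FT" "W = glue x s t"
proof -
  define f where "f a = digits (arc_edge a) (W (arc_edge a)) (arc_strand a)" for a :: "('e, 'v) strand_arc"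
  have f_prop: "f a = f (l a)" if "a \<in> D" for a
    using that by (rule l_propagate[rotated]) (use comp in \<open>auto simp: compatible_def f_def\<close>)
  define x where "x a = (if a \<in> L then f a else 0)" for a
  have f_less: "f a < d" if "a \<in> D" for a
  proof -
    have "digits (arc_edge a) (W (arc_edge a)) \<in> PiE {..<k (arc_edge a)} (\<lambda>_. {..<d})"
      using W D_arc(1)[OF that] by (intro bij_betw_apply[OF digits_bij]) (auto simp: edge_assignments_def)
    then show ?thesis using D_arc(2)[OF that] by (auto simp: f_def PiE_def)
  qed
  have "x \<in> X" using f_less L(1) by (auto simp: edge_assignments_def x_def)
  moreover have "restr SS W \<in> FS" "restr TT W \<in> FT"
    using W SS_TT by (auto simp: edge_assignments_def restr_def)
  moreover have "W = glue x (restr SS W) (restr TT W)"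
  proof
    fix e
    show "W e = glue x (restr SS W) (restr TT W) e"
    proof (cases "e \<in> E \<and> e \<notin> SS \<and> e \<notin> TT")
      case True
      have "from_digits e (strand_value x e) = W e"
      proof (rule from_digits_digits)
        show "e \<in> E" "W e < c e" using True W by (auto simp: edge_assignments_def)
        fix i assume i: "i < k e"
        show "digits e (W e) i = strand_value x e i"
        proof (cases "used e i")
          case u: True
          have "digits e (W e) i = f (arc_of e i)" using arc_of_used[OF u] by (simp add: f_def)
          also have "\<dots> = x (l (arc_of e i))"
            using f_prop l_in arc_of_used[OF u] by (simp add: x_def)
          finally show ?thesis using u by (simp add: strand_value_def)
        next
          case False
          then obtain v where "v \<in> V" "v \<in> ends e" using used_of_not_at_vertex True i by blast
          then have "digits e (W e) i = 0" using comp True i False by (auto simp: compatible_def)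
          then show ?thesis using False by (simp add: strand_value_def)
        qed
      qed
      then show ?thesis using True by (simp add: glue_def)
    next
      case False
      then show ?thesis using W SS_TT by (auto simp: glue_def restr_def edge_assignments_def)
    qed
  qed
  ultimately show ?thesis by (rule that)
qed

section \<open>Boundary indices and the contraction\<close>

definition input_index :: "(('e, 'v) strand_arc \<Rightarrow> nat) \<Rightarrow> ('e \<Rightarrow> nat) \<Rightarrow> 'v \<Rightarrow> nat" where
  "input_index x s u = (if u \<in> S then glue x s (\<lambda>_. 0) (oe u) else 0)"

definition output_index :: "(('e, 'v) strand_arc \<Rightarrow> nat) \<Rightarrow> ('e \<Rightarrow> nat) \<Rightarrow> 'v \<Rightarrow> nat" where
  "output_index x t u = (if u \<in> T then glue x (\<lambda>_. 0) t (oe u) else 0)"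

lemma oe_S: "u \<in> S \<Longrightarrow> oe u \<notin> TT" and oe_T: "u \<in> T \<Longrightarrow> oe u \<notin> SS"
  using oe[of u] disjoint by (auto simp: SS_def TT_def)

lemma input_index_glue: "u \<in> S \<Longrightarrow> glue x s t (oe u) = input_index x s u"
  and output_index_glue: "u \<in> T \<Longrightarrow> glue x s t (oe u) = output_index x t u"
  using oe_S oe_T by (auto simp: input_index_def output_index_def glue_def)

lemma zero_in: "(\<lambda>_. 0) \<in> FS" "(\<lambda>_. 0) \<in> FT"
  using c_pos SS_TT by (auto simp: edge_assignments_def)

lemma input_index_in: "x \<in> X \<Longrightarrow> s \<in> FS \<Longrightarrow> input_index x s \<in> RS"
  and output_index_in: "x \<in> X \<Longrightarrow> t \<in> FT \<Longrightarrow> output_index x t \<in> RT"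
  using glue_in[OF _ _ zero_in(2), of x s] glue_in[OF _ zero_in(1), of x t] oe
  by (auto simp: boundary_indices_def input_index_def output_index_def edge_assignments_def)

text \<open>Every path begins at an input and every edge of \<open>SS\<close> ends at one, so all of
  \<open>x\<close> and \<open>s\<close> is visible at the inputs.\<close>

lemma input_index_inj:
  assumes "x \<in> X" "x' \<in> X" "s \<in> FS" "s' \<in> FS"
  shows "input_index x s = input_index x' s' \<longleftrightarrow> x = x' \<and> s = s'"
proof
  assume eq: "input_index x s = input_index x' s'"
  have g: "glue x s (\<lambda>_. 0) (oe u) = glue x' s' (\<lambda>_. 0) (oe u)" if "u \<in> S" for u
    using fun_cong[OF eq, of u] that by (simp add: input_index_def)
  have "x a = x' a" for a
  proof (cases "a \<in> L")
    case True
    have "oe (arc_src a) = arc_edge a"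
      using L True D_arc by (intro oe_unique) auto
    then have "glue x s (\<lambda>_. 0) (arc_edge a) = glue x' s' (\<lambda>_. 0) (arc_edge a)"
      using g[of "arc_src a"] L(2) True by simp
    then have "x (l a) = x' (l a)"
      using digits_glue_arc[OF _ L(1)[OF True]] assms by metis
    then show ?thesis using L(3) True by simp
  qed (use assms edge_assignments_off in metis)
  moreover have "s e = s' e" for e
  proof (cases "e \<in> SS")
    case True
    then obtain u where u: "u \<in> ends e" "u \<in> S" using ends(2) by (auto simp: SS_def)
    then have "oe u = e" using True SS_TT by (intro oe_unique) auto
    then show ?thesis using g[OF u(2)] True by (simp add: glue_def)
  qed (use assms edge_assignments_off in metis)
  ultimately show "x = x' \<and> s = s'" by auto
qed simp

text \<open>Here each path is recognised by an arc ending in \<open>T\<close>, which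
  \<open>l_onto\<close> supplies.\<close>

lemma output_index_inj:
  assumes "x \<in> X" "x' \<in> X" "t \<in> FT" "t' \<in> FT"
  shows "output_index x t = output_index x' t' \<longleftrightarrow> x = x' \<and> t = t'"
proof
  assume eq: "output_index x t = output_index x' t'"
  have g: "glue x (\<lambda>_. 0) t (oe u) = glue x' (\<lambda>_. 0) t' (oe u)" if "u \<in> T" for u
    using fun_cong[OF eq, of u] that by (simp add: output_index_def)
  have "x b = x' b" for b
  proof (cases "b \<in> L")
    case True
    then obtain a where a: "a \<in> D" "arc_tgt a \<in> T" "l a = b" using l_onto by blast
    have "oe (arc_tgt a) = arc_edge a"
      using a D_arc by (intro oe_unique) auto
    then have "glue x (\<lambda>_. 0) t (arc_edge a) = glue x' (\<lambda>_. 0) t' (arc_edge a)"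
      using g[OF a(2)] by simp
    then have "x (l a) = x' (l a)"
      using digits_glue_arc[OF _ a(1)] assms by metis
    then show ?thesis using a by simp
  qed (use assms edge_assignments_off in metis)
  moreover have "t e = t' e" for e
  proof (cases "e \<in> TT")
    case True
    then obtain u where u: "u \<in> ends e" "u \<in> T" using ends(2) by (auto simp: TT_def)
    then have "oe u = e" using True SS_TT by (intro oe_unique) auto
    moreover have "e \<notin> SS" using True SS_TT(3) by blast
    ultimately show ?thesis using g[OF u(2)] True by (simp add: glue_def)
  qed (use assms edge_assignments_off in metis)
  ultimately show "x = x' \<and> t = t'" by auto
qed simp

lemma glue_inj:
  assumes "x \<in> X" "x' \<in> X" "s \<in> FS" "s' \<in> FS" "t \<in> FT" "t' \<in> FT" "glue x s t = glue x' s' t'"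
  shows "x = x' \<and> s = s' \<and> t = t'"
proof -
  have "input_index x s = input_index x' s'"
  proof
    fix u show "input_index x s u = input_index x' s' u"
      using input_index_glue[of u x s t] input_index_glue[of u x' s' t'] assms(7)
      by (cases "u \<in> S") (auto simp: input_index_def)
  qed
  moreover have "output_index x t = output_index x' t'"
  proof
    fix u show "output_index x t u = output_index x' t' u"
      using output_index_glue[of u x s t] output_index_glue[of u x' s' t'] assms(7)
      by (cases "u \<in> T") (auto simp: output_index_def)
  qed
  ultimately show ?thesis
    using input_index_inj output_index_inj assms by blast
qed

text \<open>Compatible assignments are parametrised by \<open>(x, t, s)\<close>. The output
  condition involves only \<open>x\<close> and \<open>t\<close>, the input condition only
  \<open>x\<close> and \<open>s\<close>, so for each \<open>x\<close> the count is a product; this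
  is the factorisation through \<open>X\<close>.\<close>

lemma beta_tensor:
  assumes IT: "IT \<in> RT" and IS: "IS \<in> RS"
  shows "beta_entry S T V E ends c tensor IT IS =
    (\<Sum>x\<in>X. of_nat (card {t \<in> FT. output_index x t = IT}) * of_nat (card {s \<in> FS. input_index x s = IS}))"
proof -
  let ?M = "{W \<in> edge_assignments E c. (\<forall>u\<in>S. W (oe u) = IS u) \<and> (\<forall>u\<in>T. W (oe u) = IT u)}"
  let ?N = "SIGMA x:X. {t \<in> FT. output_index x t = IT} \<times> {s \<in> FS. input_index x s = IS}"
  have fin: "finite ?M" "finite FS" "finite FT" "finite X"
    using finite_sets finite_SS finite_TT finite_L by (simp_all add: finite_edge_assignments)
  have in_iff: "input_index x s = IS \<longleftrightarrow> (\<forall>u\<in>S. glue x s t (oe u) = IS u)" for x s t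
    using IS input_index_glue[of _ x s t] by (auto simp: fun_eq_iff input_index_def boundary_indices_def)
  have out_iff: "output_index x t = IT \<longleftrightarrow> (\<forall>u\<in>T. glue x s t (oe u) = IT u)" for x s t
    using IT output_index_glue[of _ x s t] by (auto simp: fun_eq_iff output_index_def boundary_indices_def)
  have prod: "(\<Prod>v\<in>V. tensor v (restr (incident E ends v) W)) = of_bool (\<forall>v\<in>V. compatible v W)" for W
    unfolding tensor_def compatible_restr using finite_sets(3) by (induction V rule: finite_induct) auto
  have "beta_entry S T V E ends c tensor IT IS = of_nat (card {W \<in> ?M. \<forall>v\<in>V. compatible v W})"
    unfolding beta_entry_def prod using fin(1) by (simp add: of_bool_def sum.If_cases Int_def)
  also have "bij_betw (\<lambda>(x, t, s). glue x s t) ?N {W \<in> ?M. \<forall>v\<in>V. compatible v W}"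
    unfolding bij_betw_def
  proof
    show "inj_on (\<lambda>(x, t, s). glue x s t) ?N"
      by (rule inj_onI) (auto dest!: glue_inj[rotated 6])
    show "(\<lambda>(x, t, s). glue x s t) ` ?N = {W \<in> ?M. \<forall>v\<in>V. compatible v W}"
    proof (intro equalityI subsetI)
      fix W assume "W \<in> (\<lambda>(x, t, s). glue x s t) ` ?N"
      then show "W \<in> {W \<in> ?M. \<forall>v\<in>V. compatible v W}"
        using glue_in compatible_glue by (auto simp: input_index_glue output_index_glue)
    next
      fix W assume W: "W \<in> {W \<in> ?M. \<forall>v\<in>V. compatible v W}"
      then obtain x s t where x: "x \<in> X" "s \<in> FS" "t \<in> FT" "W = glue x s t"
        using compatible_imp_glue[of W] by blast
      with W in_iff[of x s t] out_iff[of x t s] show "W \<in> (\<lambda>(x, t, s). glue x s t) ` ?N"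
        by (intro image_eqI[of _ _ "(x, t, s)"]) auto
    qed
  qed
  then have "card {W \<in> ?M. \<forall>v\<in>V. compatible v W} = card ?N"
    by (rule bij_betw_same_card[symmetric])
  also have "card ?N = (\<Sum>x\<in>X. card {t \<in> FT. output_index x t = IT} * card {s \<in> FS. input_index x s = IS})"
    using fin by (subst card_SigmaI) (auto simp: card_cartesian_product)
  finally show ?thesis by simp
qed

lemma EE_tensor:
  "beta_nonzero S T V E ends c tensor \<and> EE S T V E ends c tensor = ln (real (d ^ card L))"
proof
  let ?g = "\<lambda>IT x. of_nat (card {t \<in> FT. output_index x t = IT}) :: complex"
  let ?h = "\<lambda>x IS. of_nat (card {s \<in> FS. input_index x s = IS}) :: complex"
  have fin: "finite FS" "finite FT" "finite X"
    using finite_SS finite_TT finite_L by (simp_all add: finite_edge_assignments)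
  have card_X: "card X = d ^ card L" using finite_L by (simp add: card_edge_assignments)
  have card_F: "card FS > 0" "card FT > 0" using zero_in fin by (auto simp: card_gt_0_iff)
  have x0: "(\<lambda>_. 0) \<in> X" using d_pos by (simp add: edge_assignments_def)
  show "beta_nonzero S T V E ends c tensor"
    unfolding beta_nonzero_def
  proof (intro bexI)
    let ?IT = "output_index (\<lambda>_. 0) (\<lambda>_. 0)" and ?IS = "input_index (\<lambda>_. 0) (\<lambda>_. 0)"
    show IT: "?IT \<in> RT" and IS: "?IS \<in> RS"
      using x0 zero_in output_index_in input_index_in by auto
    have "0 < card {t \<in> FT. output_index (\<lambda>_. 0) t = ?IT} * card {s \<in> FS. input_index (\<lambda>_. 0) s = ?IS}"
      using zero_in fin by (auto simp: card_gt_0_iff)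
    also have "\<dots> \<le> (\<Sum>x\<in>X. card {t \<in> FT. output_index x t = ?IT} * card {s \<in> FS. input_index x s = ?IS})"
      using x0 fin by (intro member_le_sum[of "\<lambda>_. 0" X]) auto
    finally show "beta_entry S T V E ends c tensor ?IT ?IS \<noteq> 0"
      unfolding beta_tensor[OF IT IS] of_nat_mult[symmetric] of_nat_sum[symmetric] of_nat_eq_0_iff by simp
  qed
  let ?G = "fun_mat RT X ?g" and ?H = "fun_mat X RS ?h"
  have C: "beta_matrix S T V E ends c tensor = ?G * ?H"
    unfolding beta_matrix_eq fun_mat_mult[OF fin(3)]
    by (rule fun_mat_cong[OF finite_RT finite_RS beta_tensor])
  \<comment> \<open>Injectivity of \<open>output_index\<close> makes the columns of the output
    factor orthogonal with equal norms; the rows of the input factor are treated alike.\<close>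
  have "mat_adjoint ?G * ?G = fun_mat X X (\<lambda>x x'. if x = x' then of_nat (card FT) else 0)"
    unfolding mat_adjoint_fun_mat fun_mat_mult[OF finite_RT]
    by (rule fun_mat_cong[OF fin(3) fin(3)], simp only: complex_cnj_of_nat,
        rule sum_card_fibres_orthogonal[OF finite_RT fin(2)]) (simp_all add: output_index_in output_index_inj)
  then have GG: "mat_adjoint ?G * ?G = of_nat (card FT) \<cdot>\<^sub>m 1\<^sub>m (card X)"
    using fun_mat_diagonal[OF fin(3)] by simp
  have "?H * mat_adjoint ?H = fun_mat X X (\<lambda>x x'. if x = x' then of_nat (card FS) else 0)"
    unfolding mat_adjoint_fun_mat fun_mat_mult[OF finite_RS]
    by (rule fun_mat_cong[OF fin(3) fin(3)], simp only: complex_cnj_of_nat,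
        rule sum_card_fibres_orthogonal[OF finite_RS fin(1)]) (simp_all add: input_index_in input_index_inj)
  then have HH: "?H * mat_adjoint ?H = of_nat (card FS) \<cdot>\<^sub>m 1\<^sub>m (card X)"
    using fun_mat_diagonal[OF fin(3)] by simp
  have "card X > 0" using card_X d_pos by simp
  then show "EE S T V E ends c tensor = ln (real (d ^ card L))"
    unfolding EE_def Let_def
    using von_neumann_entropy_eq_ln_rank[OF fun_mat_carrier fun_mat_carrier C GG HH _ _ _ refl] card_F card_X
    by simp
qed

end

section \<open>Strands of a template\<close>

context template
begin

definition cut_of :: "'v set \<Rightarrow> 'e set" where
  "cut_of X = {e \<in> E. \<exists>x\<in>ends e. \<exists>y\<in>ends e. x \<in> X \<and> y \<notin> X}"

text \<open>Among the nodes \<open>Tb\<close> is the complement of \<open>Sb\<close>, so a cut is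
  given by \<open>Sb\<close> alone. This turns edge cuts into separating sets of the directed
  network.\<close>

lemma is_edge_cut_iff: "is_edge_cut S T V E ends C \<longleftrightarrow> (\<exists>X. S \<subseteq> X \<and> X \<subseteq> S \<union> V \<and> C = cut_of X)"
proof
  assume "is_edge_cut S T V E ends C"
  then obtain Sb Tb where "Sb \<union> Tb = S \<union> T \<union> V" "Sb \<inter> Tb = {}" "S \<subseteq> Sb" "T \<subseteq> Tb"
    and C: "C = {e \<in> E. \<exists>x\<in>ends e. \<exists>y\<in>ends e. x \<in> Sb \<and> y \<in> Tb}"
    by (auto simp: is_edge_cut_def nodes_def)
  moreover from this have iff: "y \<in> Tb \<longleftrightarrow> y \<notin> Sb" if "e \<in> E" "y \<in> ends e" for e y
    using ends(1)[OF that(1)] that(2) by blast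
  have "C = cut_of Sb"
    unfolding C cut_of_def by (intro Collect_cong conj_cong refl bex_cong iff)
  ultimately show "\<exists>X. S \<subseteq> X \<and> X \<subseteq> S \<union> V \<and> C = cut_of X"
    by (intro exI[of _ Sb]) auto
next
  assume "\<exists>X. S \<subseteq> X \<and> X \<subseteq> S \<union> V \<and> C = cut_of X"
  then obtain X where X: "S \<subseteq> X" "X \<subseteq> S \<union> V" "C = cut_of X" by blast
  have iff: "y \<notin> X \<longleftrightarrow> y \<in> S \<union> T \<union> V - X" if "e \<in> E" "y \<in> ends e" for e y
    using ends(1)[OF that(1)] that(2) by blast
  have "C = {e \<in> E. \<exists>x\<in>ends e. \<exists>y\<in>ends e. x \<in> X \<and> y \<in> S \<union> T \<union> V - X}"
    unfolding X(3) cut_of_def by (intro Collect_cong conj_cong refl bex_cong iff)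
  moreover have "X \<union> (S \<union> T \<union> V - X) = S \<union> T \<union> V" "X \<inter> (S \<union> T \<union> V - X) = {}"
    "T \<subseteq> S \<union> T \<union> V - X"
    using X disjoint by auto
  ultimately show "is_edge_cut S T V E ends C"
    unfolding is_edge_cut_def nodes_def using X(1)
    by (intro exI[of _ X] exI[of _ "S \<union> T \<union> V - X"] conjI)
qed

text \<open>An undirected edge of capacity \<open>d ^ k e\<close> becomes \<open>k e\<close> strands, each carrying one
  base-\<open>d\<close> digit, and each strand becomes two opposite arcs.\<close>

definition strand_arcs :: "('e \<Rightarrow> nat) \<Rightarrow> ('e, 'v) strand_arc set" where
  "strand_arcs k = {a. arc_edge a \<in> E \<and> arc_strand a < k (arc_edge a) \<and>
     ends (arc_edge a) = {arc_src a, arc_tgt a} \<and> arc_src a \<noteq> arc_tgt a}"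

lemma finite_strand_arcs: "finite (strand_arcs k)"
proof (rule finite_subset)
  show "strand_arcs k \<subseteq> (SIGMA e:E. {..<k e} \<times> (S \<union> T \<union> V) \<times> (S \<union> T \<union> V))"
    using ends(1) by (fastforce simp: strand_arcs_def)
  show "finite (SIGMA e:E. {..<k e} \<times> (S \<union> T \<union> V) \<times> (S \<union> T \<union> V))"
    using finite_sets by simp
qed

text \<open>For a cut edge exactly one orientation of each strand leaves \<open>X\<close>, and other
  edges contribute nothing. So directed cuts of arcs compute the exponents of undirected
  cuts.\<close>

lemma card_strand_arcs_leaving:
  "card {a \<in> strand_arcs k. arc_src a \<in> X \<and> arc_tgt a \<notin> X} = (\<Sum>e\<in>cut_of X. k e)"
proof -
  let ?A = "{a \<in> strand_arcs k. arc_src a \<in> X \<and> arc_tgt a \<notin> X}"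
  have "bij_betw (\<lambda>a. (arc_edge a, arc_strand a)) ?A (SIGMA e:cut_of X. {..<k e})"
    unfolding bij_betw_def
  proof
    show "inj_on (\<lambda>a. (arc_edge a, arc_strand a)) ?A"
    proof (rule inj_onI)
      fix a b assume ab: "a \<in> ?A" "b \<in> ?A" and eq: "(arc_edge a, arc_strand a) = (arc_edge b, arc_strand b)"
      then have "{arc_src a, arc_tgt a} = {arc_src b, arc_tgt b}"
        by (simp add: strand_arcs_def)
      moreover have "arc_src a \<in> X" "arc_src b \<in> X" "arc_tgt a \<notin> X" "arc_tgt b \<notin> X"
        using ab by auto
      ultimately have "arc_src a = arc_src b" "arc_tgt a = arc_tgt b"
        by (auto simp: doubleton_eq_iff)
      with eq show "a = b" by (simp add: prod_eq_iff)
    qed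
    show "(\<lambda>a. (arc_edge a, arc_strand a)) ` ?A = (SIGMA e:cut_of X. {..<k e})"
    proof (intro equalityI subsetI)
      fix p assume "p \<in> (SIGMA e:cut_of X. {..<k e})"
      then obtain e i where p: "p = (e, i)" "e \<in> cut_of X" "i < k e" by auto
      then obtain x y where xy: "e \<in> E" "x \<in> ends e" "y \<in> ends e" "x \<in> X" "y \<notin> X"
        by (auto simp: cut_of_def)
      have "finite (ends e)" using ends(1)[OF xy(1)] finite_sets by (auto intro: finite_subset)
      moreover have "x \<noteq> y" using xy by auto
      ultimately have "{x, y} = ends e"
        using xy ends(3)[OF xy(1)] by (intro card_seteq) auto
      then show "p \<in> (\<lambda>a. (arc_edge a, arc_strand a)) ` ?A"
        using xy p \<open>x \<noteq> y\<close> by (intro image_eqI[of _ _ "(e, i, x, y)"]) (auto simp: strand_arcs_def)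
    qed (auto simp: strand_arcs_def cut_of_def)
  qed
  from bij_betw_same_card[OF this] show ?thesis
    using finite_sets by (subst (asm) card_SigmaI) (auto simp: cut_of_def)
qed

lemma tensor_attaining_QMC:
  assumes d: "d > 0" and c: "\<And>e. e \<in> E \<Longrightarrow> c e = d ^ k e"
  shows "\<exists>Tn. beta_nonzero S T V E ends c Tn \<and>
    EE S T V E ends c Tn = ln (real (QMC S T V E ends c))"
proof -
  define weight where "weight X = (\<Sum>e\<in>cut_of X. k e)" for X
  \<comment> \<open>The exponent of \<open>QMC\<close> is defined through sums of \<open>k\<close>
    rather than as a logarithm, since for \<open>d = 1\<close> the capacities do not determine
    it.\<close>
  define m where "m = Min (weight ` {X. S \<subseteq> X \<and> X \<subseteq> S \<union> V})"
  have fin: "finite {X. S \<subseteq> X \<and> X \<subseteq> S \<union> V}"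
    by (rule finite_subset[of _ "Pow (S \<union> V)"]) (use finite_sets in auto)
  have m_le: "m \<le> weight X" if "S \<subseteq> X" "X \<subseteq> S \<union> V" for X
    unfolding m_def using that fin by (intro Min_le) auto
  have "m \<in> weight ` {X. S \<subseteq> X \<and> X \<subseteq> S \<union> V}"
    unfolding m_def using fin by (intro Min_in) auto
  then obtain X0 where X0: "S \<subseteq> X0" "X0 \<subseteq> S \<union> V" "weight X0 = m" by auto
  have prod_c: "(\<Prod>e\<in>cut_of X. c e) = d ^ weight X" for X
    unfolding weight_def power_sum by (rule prod.cong) (auto simp: c cut_of_def)
  have "QMC S T V E ends c = d ^ m"
  proof (rule antisym)
    show "QMC S T V E ends c \<le> d ^ m"
      using QMC_le[of "cut_of X0"] X0 by (auto simp: is_edge_cut_iff prod_c)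
    obtain X where "S \<subseteq> X" "X \<subseteq> S \<union> V" "QMC S T V E ends c = d ^ weight X"
      using QMC_attained by (metis is_edge_cut_iff prod_c)
    then show "d ^ m \<le> QMC S T V E ends c"
      using m_le d by (simp add: power_increasing)
  qed
  interpret net: min_cut_network "strand_arcs k" arc_src arc_tgt S T V m
  proof
    show "arc_src a \<in> S \<union> T \<union> V" "arc_tgt a \<in> S \<union> T \<union> V" if "a \<in> strand_arcs k" for a
      using that ends(1)[of "arc_edge a"] by (auto simp: strand_arcs_def)
  qed (use finite_sets finite_strand_arcs disjoint m_le X0 in \<open>auto simp: card_strand_arcs_leaving weight_def\<close>)
  obtain D where "net.m_connected D" "\<forall>a\<in>D. \<not> net.m_connected (D - {a})"
    using net.minimal_m_connected_exists by blast
  then interpret mini: minimal_network "strand_arcs k" arc_src arc_tgt S T V m D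
    by unfold_locales auto
  obtain l where l: "\<And>a. a \<in> mini.sources \<Longrightarrow> l a = a" "\<And>a. a \<in> D \<Longrightarrow> l a \<in> mini.sources"
    "l ` {a \<in> D. arc_tgt a \<in> T} = mini.sources"
    "\<And>(f :: ('e, 'v) strand_arc \<Rightarrow> nat) a.
      (\<And>a b. a \<in> D \<Longrightarrow> b \<in> D \<Longrightarrow> arc_tgt a = arc_src b \<Longrightarrow> l a = l b \<Longrightarrow> f a = f b) \<Longrightarrow>
      a \<in> D \<Longrightarrow> f a = f (l a)"
    using mini.labelling[where 'b = nat] by blast
  have DA: "a \<in> strand_arcs k" if "a \<in> D" for a using mini.D_subset that by auto
  interpret routed: routed_template S T V E ends c d k D l mini.sources
  proof
    fix a b assume ab: "a \<in> D" "b \<in> D" "arc_edge a = arc_edge b" "arc_strand a = arc_strand b"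
    have "{arc_src a, arc_tgt a} = {arc_src b, arc_tgt b}"
      using DA[OF ab(1)] DA[OF ab(2)] ab(3) by (simp add: strand_arcs_def)
    \<comment> \<open>Heights increase strictly along arcs, so \<open>D\<close> never contains both
      orientations of one strand.\<close>
    moreover have "\<not> (arc_src a = arc_tgt b \<and> arc_tgt a = arc_src b)"
      using mini.height_less[OF ab(1)] mini.height_less[OF ab(2)] by auto
    ultimately show "a = b" using ab by (auto simp: doubleton_eq_iff prod_eq_iff)
  next
    fix e i u w assume "e \<in> E" "i < k e" "u \<in> S" "w \<in> T" "ends e = {u, w}"
    then show "(e, i, u, w) \<in> D"
      using disjoint by (intro mini.saturated) (auto simp: strand_arcs_def)
  next
    fix f :: "('e, 'v) strand_arc \<Rightarrow> nat" and a
    assume f: "\<And>a b. a \<in> D \<Longrightarrow> b \<in> D \<Longrightarrow> arc_tgt a \<in> V \<Longrightarrow> arc_tgt a = arc_src b \<Longrightarrow> l a = l b \<Longrightarrow> f a = f b"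
      and a: "a \<in> D"
    show "f a = f (l a)"
    proof (rule l(4)[OF _ a])
      fix a b assume ab: "a \<in> D" "b \<in> D" "arc_tgt a = arc_src b" "l a = l b"
      have "arc_tgt a \<in> V"
        using net.arcs(2)[OF DA[OF ab(1)]] mini.arc_not_to_S[OF ab(1)] mini.arc_not_from_T[OF ab(2)] ab(3) by auto
      then show "f a = f b" using f ab by blast
    qed
  next
    fix b assume "b \<in> mini.sources"
    then show "\<exists>a\<in>D. arc_tgt a \<in> T \<and> l a = b" unfolding l(3)[symmetric] by auto
  qed (use d c DA mini.arc_not_to_S mini.arc_not_from_T l(1,2) mini.finite_D in
      \<open>auto simp: strand_arcs_def mini.sources_def\<close>)
  show ?thesis
    using routed.EE_tensor unfolding mini.card_sources \<open>QMC S T V E ends c = d ^ m\<close> by blast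
qed

end

text \<open>The maximum MEE is expressed by an entropy that is attained and that bounds all
  others.\<close>

theorem theorem5p2:
  fixes S T V :: "'v set" and E :: "'e set" and ends :: "'e \<Rightarrow> 'v set"
    and c :: "'e \<Rightarrow> nat" and d :: nat
  assumes "tn_template S T V E ends c"
    and "d > 0"
    and "\<forall>e\<in>E. \<exists>k. c e = d ^ k"
  shows "(\<exists>Tn. beta_nonzero S T V E ends c Tn \<and>
              EE S T V E ends c Tn = ln (real (QMC S T V E ends c))) \<and>
         (\<forall>Tn. beta_nonzero S T V E ends c Tn \<longrightarrow>
              EE S T V E ends c Tn \<le> ln (real (QMC S T V E ends c)))"
proof -
  interpret template S T V E ends c by unfold_locales fact
  obtain k where "\<And>e. e \<in> E \<Longrightarrow> c e = d ^ k e" using assms(3) by metis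
  then show ?thesis using tensor_attaining_QMC[OF assms(2)] EE_le_ln_QMC by blast
qed

end
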